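(* Let $\lambda,\theta$ be regular uncountable cardinals with $\lambda>\theta^{+\omega}$ and $2^{\theta^{+n}}<\lambda$ for every $n<\omega$. (1) If $S^{\rm bd}_{\lambda,\theta}$ is well defined and stationary, then there are $n<\omega$ and a stationary $S\subseteq S^\lambda_{\theta^{+n}}$ which reflects in no ordinal $\delta$ of cofinality $\in[\theta,\theta^{+\omega})$. (2) There is $S\in\check I_\theta[\lambda]$ such that for every $n\ge2$, letting $S_1=S^\lambda_{\theta^{+n}}\cap\mathrm{refl}(\lambda\setminus S)$, either $S_1$ is not stationary in $\lambda$, or $S_1$ is stationary but is the union of $\le2^{\theta^{+n}}$ sets each of which reflects in no $\delta$ of cofinality $\in[\theta^{+n+2},\theta^{+\omega})$. (3) If $S$ is as in (2), $n\ge 2$, and the second possibility of (2) holds for $n$ and $S_1=S^\lambda_{\theta^{+n}}\cap\mathrm{refl}(\lambda\setminus S)$, then there is a stationary $S_2\subseteq S_1$ such that either $S_2$ reflects in no ordinal of cofinality $<\theta^{+\omega}$, or $$S_3=\{\delta\in S^\lambda_{\theta^{+n+1}}:S_2\cap\delta\text{ is stationary in }\delta\}$$ is a stationary subset of $S^\lambda_{\theta^{+n+1}}$ which reflects in no $\delta<\lambda$ of cofinality $<\theta^{+\omega}$.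
   Context: For regular $\kappa<\lambda$, $S^\lambda_\kappa=\{\delta<\lambda:\mathrm{cf}(\delta)=\kappa\}$. A set $S\subseteq\lambda$ reflects in $\delta<\lambda$ if $\mathrm{cf}(\delta)>\aleph_0$ and $S\cap\delta$ is a stationary subset of $\delta$; $\mathrm{refl}(S)=\{\delta<\lambda:\mathrm{cf}(\delta)>\aleph_0\text{ and }S\text{ reflects in }\delta\}$. A $(\lambda,\lambda,<\lambda)$-system is a sequence $\bar{\mathcal P}=\langle\mathcal P_\alpha:\alpha<\lambda\rangle$ such that for each $\alpha$: every $a\in\mathcal P_\alpha$ satisfies $a\subseteq\alpha$ and $|a|<\lambda$; if $\beta\in a\in\mathcal P_\alpha$ then $a\cap\beta\in\mathcal P_\beta$; and $|\mathcal P_\alpha|<\lambda$. $\mathrm{good}''_\theta(\bar{\mathcal P})$ is the set of $\delta<\lambda$ with $\mathrm{cf}(\delta)=\theta$ for which there is an unbounded $u\subseteq\delta$ of order type $\theta$ such that $u\in\mathcal P_\delta$ and $u\cap\alpha\in\mathcal P_\alpha$ for every $\alpha\in u$. $\check I_\theta[\lambda]$ is the family of $S\subseteq S^\lambda_\theta$ such that for some $(\lambda,\lambda,<\lambda)$-system $\bar{\mathcal P}$ and some club $E$ of $\lambda$ we have $S\cap E\subseteq\mathrm{good}''_\theta(\bar{\mathcal P})$. By convention, for an arbitrary $S\subseteq\lambda$ (possibly containing ordinals of cofinality $\ne\theta$), $S\in\check I_\theta[\lambda]$ means $S\cap S^\lambda_\theta\in\check I_\theta[\lambda]$. $S^{\rm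 bd}_{\lambda,\theta}$ is well defined if there is $S_*\subseteq S^\lambda_\theta$ such that $\check I_\theta[\lambda]$ is the ideal on $S^\lambda_\theta$ generated by the non-stationary subsets of $S^\lambda_\theta$ together with $S_*$; in this case $S^{\rm bd}_{\lambda,\theta}:=S^\lambda_\theta\setminus S_*$, which is unique modulo the club filter on $\lambda$. *)

theory Defs
  imports "HOL-Library.Countable_Set"
begin

unbundle cardinal_syntax

text \<open>
  The cardinal \<open>\<lambda>\<close> is represented by a type \<open>'a :: wellorder\<close>: its elements are the
  ordinals below \<open>\<lambda>\<close>, an ordinal \<open>\<delta> < \<lambda>\<close>, read as a set, is \<open>{..<\<delta>}\<close>, and \<open>\<lambda>\<close> itself is
  \<open>UNIV\<close>. Notions needed both for \<open>\<lambda>\<close> and for some \<open>\<delta> < \<lambda>\<close> take the corresponding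
  initial segment \<open>D\<close> as an argument.
\<close>

definition ord_rel :: "'a::wellorder set \<Rightarrow> 'a rel" where
  "ord_rel A = {(x, y). x \<in> A \<and> y \<in> A \<and> x \<le> y}"

definition regular_uncountable :: "'a::wellorder set \<Rightarrow> bool" where
  "regular_uncountable D \<longleftrightarrow>
     Card_order (ord_rel D) \<and> regularCard (ord_rel D) \<and> uncountable D"

text \<open>
  For \<open>D\<close> a successor ordinal the non-strict inequality makes the singleton of the
  predecessor unbounded, so that successors have cofinality 1. For limits it does not
  matter.
\<close>

definition unbounded_in :: "'a::wellorder set \<Rightarrow> 'a set \<Rightarrow> bool" where
  "unbounded_in u D \<longleftrightarrow> u \<subseteq> D \<and> (\<forall>\<beta>\<in>D. \<exists>\<gamma>\<in>u. \<beta> \<le> \<gamma>)"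

definition limit_ord :: "'a::wellorder \<Rightarrow> bool" where
  "limit_ord \<gamma> \<longleftrightarrow> (\<exists>\<beta>. \<beta> < \<gamma>) \<and> (\<forall>\<beta><\<gamma>. \<exists>\<xi>. \<beta> < \<xi> \<and> \<xi> < \<gamma>)"

definition has_order_type :: "'a::wellorder set \<Rightarrow> 'a \<Rightarrow> bool" where
  "has_order_type u \<alpha> \<longleftrightarrow> ord_rel u =o ord_rel {..<\<alpha>}"

definition cf :: "'a::wellorder \<Rightarrow> 'a" where
  "cf \<delta> = (LEAST \<alpha>. \<exists>u. unbounded_in u {..<\<delta>} \<and> has_order_type u \<alpha>)"

definition S_cof :: "'a::wellorder \<Rightarrow> 'a set" where
  "S_cof \<kappa> = {\<delta>. cf \<delta> = \<kappa>}"

definition club_in :: "'a::wellorder set \<Rightarrow> 'a set \<Rightarrow> bool" where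
  "club_in C D \<longleftrightarrow> unbounded_in C D \<and>
     (\<forall>\<gamma>\<in>D. limit_ord \<gamma> \<and> unbounded_in (C \<inter> {..<\<gamma>}) {..<\<gamma>} \<longrightarrow> \<gamma> \<in> C)"

definition stationary_in :: "'a::wellorder set \<Rightarrow> 'a set \<Rightarrow> bool" where
  "stationary_in S D \<longleftrightarrow> S \<subseteq> D \<and> (\<forall>C. club_in C D \<longrightarrow> S \<inter> C \<noteq> {})"

text \<open>Here \<open>uncountable {..<cf \<delta>}\<close> says that the cofinality of \<open>\<delta>\<close> exceeds \<open>\<aleph>\<^sub>0\<close>.\<close>

definition reflects_in :: "'a::wellorder set \<Rightarrow> 'a \<Rightarrow> bool" where
  "reflects_in S \<delta> \<longleftrightarrow> uncountable {..<cf \<delta>} \<and> stationary_in (S \<inter> {..<\<delta>}) {..<\<delta>}"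

definition refl_set :: "'a::wellorder set \<Rightarrow> 'a set" where
  "refl_set S = {\<delta>. uncountable {..<cf \<delta>} \<and> reflects_in S \<delta>}"

text \<open>
  Cardinal successors are initial ordinals, computed below \<open>\<lambda>\<close>. The values \<open>\<theta>\<^sup>+\<^sup>n\<close> and
  \<open>\<theta>\<^sup>+\<^sup>\<omega>\<close> are meaningful when they lie below \<open>\<lambda>\<close>, which is what
  \<open>plus_omega_below\<close> expresses: some \<open>\<kappa> < \<lambda>\<close> has cardinality above every \<open>\<theta>\<^sup>+\<^sup>n\<close>, and
  the least such \<open>\<kappa>\<close> is \<open>\<theta>\<^sup>+\<^sup>\<omega>\<close>.
\<close>

definition card_succ :: "'a::wellorder \<Rightarrow> 'a" where
  "card_succ \<kappa> = (LEAST \<mu>. |{..<\<kappa>}| <o |{..<\<mu>}| )"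

definition card_plus :: "'a::wellorder \<Rightarrow> nat \<Rightarrow> 'a" where
  "card_plus \<theta> n = (card_succ ^^ n) \<theta>"

definition plus_omega_below :: "'a::wellorder \<Rightarrow> bool" where
  "plus_omega_below \<theta> \<longleftrightarrow> (\<exists>\<kappa> :: 'a. \<forall>n. |{..<card_plus \<theta> n}| <o |{..<\<kappa>}| )"

definition card_plus_omega :: "'a::wellorder \<Rightarrow> 'a" where
  "card_plus_omega \<theta> = (LEAST \<kappa>. \<forall>n. |{..<card_plus \<theta> n}| <o |{..<\<kappa>}| )"

definition small_system :: "('a::wellorder \<Rightarrow> 'a set set) \<Rightarrow> bool" where
  "small_system P \<longleftrightarrow> (\<forall>\<alpha>.
     (\<forall>a\<in>P \<alpha>. a \<subseteq> {..<\<alpha>} \<and> |a| <o |UNIV :: 'a set| ) \<and>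
     (\<forall>a\<in>P \<alpha>. \<forall>\<beta>\<in>a. a \<inter> {..<\<beta>} \<in> P \<beta>) \<and>
     |P \<alpha>| <o |UNIV :: 'a set| )"

definition good'' :: "'a::wellorder \<Rightarrow> ('a \<Rightarrow> 'a set set) \<Rightarrow> 'a set" where
  "good'' \<theta> P = {\<delta>. cf \<delta> = \<theta> \<and>
     (\<exists>u. unbounded_in u {..<\<delta>} \<and> has_order_type u \<theta> \<and> u \<in> P \<delta> \<and>
          (\<forall>\<alpha>\<in>u. u \<inter> {..<\<alpha>} \<in> P \<alpha>))}"

definition I_check :: "'a::wellorder \<Rightarrow> 'a set set" where
  "I_check \<theta> = {S. S \<subseteq> S_cof \<theta> \<and>
     (\<exists>P E. small_system P \<and> club_in E UNIV \<and> S \<inter> E \<subseteq> good'' \<theta> P)}"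

text \<open>Membership in the same ideal, by convention, for an arbitrary \<open>S \<subseteq> \<lambda>\<close>.\<close>

definition in_I_check :: "'a::wellorder \<Rightarrow> 'a set \<Rightarrow> bool" where
  "in_I_check \<theta> S \<longleftrightarrow> S \<inter> S_cof \<theta> \<in> I_check \<theta>"

text \<open>Ideals of sets need not be proper.\<close>

definition set_ideal_on :: "'b set \<Rightarrow> 'b set set \<Rightarrow> bool" where
  "set_ideal_on X I \<longleftrightarrow> I \<subseteq> Pow X \<and> {} \<in> I \<and>
     (\<forall>A\<in>I. \<forall>B. B \<subseteq> A \<longrightarrow> B \<in> I) \<and> (\<forall>A\<in>I. \<forall>B\<in>I. A \<union> B \<in> I)"

definition generated_ideal :: "'b set \<Rightarrow> 'b set set \<Rightarrow> 'b set set" where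
  "generated_ideal X G = \<Inter>{I. set_ideal_on X I \<and> G \<subseteq> I}"

text \<open>
  As \<open>S\<^sup>b\<^sup>d\<close> is only determined modulo the club filter, it is a predicate here; it is
  well defined iff some \<open>B\<close> satisfies it.
\<close>

definition is_S_bd :: "'a::wellorder \<Rightarrow> 'a set \<Rightarrow> bool" where
  "is_S_bd \<theta> B \<longleftrightarrow> (\<exists>S'. S' \<subseteq> S_cof \<theta> \<and> B = S_cof \<theta> - S' \<and>
     I_check \<theta> = generated_ideal (S_cof \<theta>)
       ({A. A \<subseteq> S_cof \<theta> \<and> \<not> stationary_in A UNIV} \<union> {S'}))"

definition S_one :: "'a::wellorder \<Rightarrow> 'a set \<Rightarrow> nat \<Rightarrow> 'a set" where
  "S_one \<theta> S n = S_cof (card_plus \<theta> n) \<inter> refl_set (UNIV - S)"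

definition second_possibility :: "'a::wellorder \<Rightarrow> 'a set \<Rightarrow> nat \<Rightarrow> bool" where
  "second_possibility \<theta> S n \<longleftrightarrow> stationary_in (S_one \<theta> S n) UNIV \<and>
     (\<exists>F. |F| \<le>o ctwo ^c |{..<card_plus \<theta> n}| \<and> S_one \<theta> S n = \<Union>F \<and>
        (\<forall>A\<in>F. \<forall>\<delta>. cf \<delta> \<in> {card_plus \<theta> (n + 2)..<card_plus_omega \<theta>} \<longrightarrow>
           \<not> reflects_in A \<delta>))"

definition dichotomy_set :: "'a::wellorder \<Rightarrow> 'a set \<Rightarrow> bool" where
  "dichotomy_set \<theta> S \<longleftrightarrow> in_I_check \<theta> S \<and>
     (\<forall>n\<ge>2. \<not> stationary_in (S_one \<theta> S n) UNIV \<or> second_possibility \<theta> S n)"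

end

theory Submission
  imports Defs
begin

text \<open>
  Fix for every \<open>\<gamma>\<close> with \<open>cf \<gamma> = \<theta>\<^sup>+\<^sup>n\<close> an increasing continuous enumeration \<open>h \<gamma>\<close> of a
  club \<open>e \<gamma>\<close> of \<open>\<gamma>\<close>, and let \<open>S\<close> consist of the \<open>\<delta>\<close> of cofinality \<open>\<theta>\<close> with a cofinal
  set each of whose initial segments, cut at one of its elements \<open>\<beta>\<close>, lies in \<open>e \<gamma>\<close>
  for some \<open>\<gamma> \<le> \<beta>\<close>. As \<open>2\<close> to the power \<open>\<theta>\<^sup>+\<^sup>n\<close> is below the regular \<open>\<lambda>\<close>, the subsets
  of these \<open>e \<gamma>\<close> form a small system, so \<open>S\<close> is in the ideal. Colour a point of cofinality
  \<open>\<kappa> = \<theta>\<^sup>+\<^sup>n\<close> by the set \<open>X \<subseteq> \<kappa>\<close> of indices at which \<open>h\<close> takes values outside \<open>S\<close>.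
  Suppose a colour class is stationary in \<open>\<delta>\<close> with \<open>cf \<delta> = \<tau> > \<kappa>\<^sup>+\<close>. Two facts of Shelah
  apply: club guessing on \<open>X\<close>, which needs \<open>n \<ge> 2\<close>, and approachability of the points of
  cofinality \<open>\<kappa>\<close> in \<open>\<tau>\<close>, which holds because \<open>\<tau>\<close> is the successor of a regular
  cardinal above \<open>\<kappa>\<close>. Together they yield a point outside \<open>S\<close> with a cofinal set as above.

  Parts (3) and (1) follow since stationary reflection is transitive: a stationary set of
  cofinality \<open>\<kappa>\<close> which reflects at most at cofinality \<open>\<kappa>\<^sup>+\<close> either stops reflecting on a
  club, or its set of reflection points is stationary and does not reflect.
\<close>

subsection \<open>Order types and cofinality\<close>

lemma Field_ord_rel [simp]: "Field (ord_rel A) = A"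
  by (auto simp: ord_rel_def Field_def)

lemma Well_order_ord_rel: "Well_order (ord_rel (A :: 'a::wellorder set))"
proof -
  have "wf (ord_rel A - Id)"
    by (rule wf_subset[OF wf]) (auto simp: ord_rel_def)
  moreover have "Linear_order (ord_rel A)"
    unfolding linear_order_on_def partial_order_on_def preorder_on_def total_on_def
      refl_on_def trans_def antisym_def Field_ord_rel
    by (auto simp: ord_rel_def)
  ultimately show ?thesis by (simp add: well_order_on_def)
qed

lemma has_order_type_iff:
  fixes u :: "'a::wellorder set"
  shows "has_order_type u \<alpha> \<longleftrightarrow>
    (\<exists>f. bij_betw f {..<\<alpha>} u \<and> (\<forall>x<\<alpha>. \<forall>y<x. f y < f x))" (is "?L \<longleftrightarrow> ?R")
proof
  assume ?L
  then have "ord_rel {..<\<alpha>} =o ord_rel u"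
    unfolding has_order_type_def by (rule ordIso_symmetric)
  then obtain f where f: "iso (ord_rel {..<\<alpha>}) (ord_rel u) f"
    by (auto simp: ordIso_def)
  then have b: "bij_betw f {..<\<alpha>} u"
    and c: "\<And>a b. a < \<alpha> \<Longrightarrow> b < \<alpha> \<Longrightarrow>
      (a, b) \<in> ord_rel {..<\<alpha>} \<longleftrightarrow> (f a, f b) \<in> ord_rel u"
    by (simp_all add: iso_iff2)
  have "f y < f x" if "x < \<alpha>" "y < x" for x y
  proof -
    have "y < \<alpha>" using that by simp
    then have "(f x, f y) \<notin> ord_rel u" using c[of x y] that leD by (auto simp: ord_rel_def)
    moreover have "f x \<in> u" "f y \<in> u" using b that \<open>y < \<alpha>\<close> by (auto simp: bij_betw_def)
    ultimately show ?thesis by (auto simp: ord_rel_def)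
  qed
  with b show ?R by blast
next
  assume ?R
  then obtain f where b: "bij_betw f {..<\<alpha>} u" and m: "\<forall>x<\<alpha>. \<forall>y<x. f y < f x"
    by blast
  have "f a \<in> u" if "a < \<alpha>" for a using b that by (auto simp: bij_betw_def)
  then have "iso (ord_rel {..<\<alpha>}) (ord_rel u) f"
    using b m unfolding iso_iff2 Field_ord_rel
    by (auto simp: ord_rel_def) (metis linorder_not_less nless_le)+
  then have "ord_rel {..<\<alpha>} =o ord_rel u"
    using Well_order_ord_rel by (auto simp: ordIso_def)
  then show ?L unfolding has_order_type_def by (rule ordIso_symmetric)
qed

text \<open>The transitive collapse: the value at \<open>x\<close> is the order type of
  \<open>A \<inter> {..<x}\<close>. It is defined for \<open>x\<close> outside \<open>A\<close> too,
  so that \<open>collapse A \<alpha>\<close> serves as the order type of a subset \<open>A\<close>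
  of \<open>\<alpha>\<close>.\<close>

definition collapse :: "'a::wellorder set \<Rightarrow> 'a \<Rightarrow> 'a" where
  "collapse A = wfrec {(x, y). x < y} (\<lambda>c x. LEAST y. \<forall>z\<in>A. z < x \<longrightarrow> c z < y)"

lemma collapse_rec: "collapse A x = (LEAST y. \<forall>z\<in>A. z < x \<longrightarrow> collapse A z < y)"
proof -
  have "collapse A x = (LEAST y. \<forall>z\<in>A. z < x \<longrightarrow> cut (collapse A) {(x, y). x < y} x z < y)"
    unfolding collapse_def by (subst wfrec[OF wf]) simp
  then show ?thesis by (simp add: cut_def cong: conj_cong imp_cong)
qed

text \<open>Inductively \<open>x\<close> is itself a strict upper bound of the earlier values. This
  is also why the \<open>LEAST\<close> is attained, and why a subset of an ordinal has no larger
  order type.\<close>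

lemma collapse_le: "collapse A x \<le> x"
proof (induction x rule: less_induct)
  case (less x)
  then show ?case by (subst collapse_rec) (rule Least_le, force)
qed

lemma collapse_less: assumes "z \<in> A" "z < x" shows "collapse A z < collapse A x"
proof -
  have "\<forall>z\<in>A. z < x \<longrightarrow> collapse A z < x"
    using collapse_le le_less_trans by blast
  then have "\<forall>z\<in>A. z < x \<longrightarrow> collapse A z < collapse A x"
    by (subst (2) collapse_rec) (rule LeastI)
  with assms show ?thesis by blast
qed

text \<open>A value \<open>w\<close> below the least strict upper bound is no such bound, so an
  earlier member has value at least \<open>w\<close>; if that value is larger, descend to this
  member.\<close>

lemma collapse_onto: "w < collapse A x \<Longrightarrow> \<exists>z\<in>A. z < x \<and> collapse A z = w"
proof (induction x rule: less_induct)
  case (less x)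
  from less.prems have "\<not> (\<forall>z\<in>A. z < x \<longrightarrow> collapse A z < w)"
    by (subst (asm) collapse_rec) (drule not_less_Least, simp)
  then obtain z where z: "z \<in> A" "z < x" "w \<le> collapse A z" by (auto simp: not_less)
  show ?case
  proof (cases "w = collapse A z")
    case True then show ?thesis using z by blast
  next
    case False
    then have "\<exists>z'\<in>A. z' < z \<and> collapse A z' = w" using less.IH[of z] z by simp
    then show ?thesis using z by (meson order.strict_trans)
  qed
qed

lemma collapse_cong: "A \<inter> {..<x} = B \<inter> {..<x} \<Longrightarrow> collapse A x = collapse B x"
proof (induction x rule: less_induct)
  case (less x)
  have "collapse A z = collapse B z" if "z < x" for z
    by (rule less.IH[OF that]) (use less.prems that in fastforce)
  moreover have "z \<in> A \<longleftrightarrow> z \<in> B" if "z < x" for z using less.prems that by blast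
  ultimately have "(\<forall>z\<in>A. z < x \<longrightarrow> collapse A z < y) \<longleftrightarrow>
      (\<forall>z\<in>B. z < x \<longrightarrow> collapse B z < y)" for y by auto
  then show ?case by (simp add: collapse_rec[of A x] collapse_rec[of B x])
qed

lemma collapse_bij_betw:
  fixes A :: "'a::wellorder set"
  assumes "A \<subseteq> {..<\<alpha>}"
  shows "bij_betw (collapse A) A {..<collapse A \<alpha>}"
  unfolding bij_betw_def
proof
  show "inj_on (collapse A) A"
    by (rule inj_onI) (metis collapse_less less_irrefl neqE)
  show "collapse A ` A = {..<collapse A \<alpha>}"
  proof
    show "collapse A ` A \<subseteq> {..<collapse A \<alpha>}" using assms collapse_less[of _ A \<alpha>] by auto
    show "{..<collapse A \<alpha>} \<subseteq> collapse A ` A"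
      using collapse_onto[of _ A \<alpha>] by (metis imageI lessThan_iff subsetI)
  qed
qed

lemma has_order_type_collapse:
  fixes A :: "'a::wellorder set"
  assumes "A \<subseteq> {..<\<alpha>}"
  shows "has_order_type A (collapse A \<alpha>)"
proof -
  let ?g = "the_inv_into A (collapse A)"
  have b: "bij_betw (collapse A) A {..<collapse A \<alpha>}" by (rule collapse_bij_betw[OF assms])
  then have g: "bij_betw ?g {..<collapse A \<alpha>} A" by (rule bij_betw_the_inv_into)
  have "?g y < ?g x" if "x < collapse A \<alpha>" "y < x" for x y
  proof -
    have y: "y < collapse A \<alpha>" using that by auto
    with that g have "?g x \<in> A" "?g y \<in> A" by (auto simp: bij_betw_def)
    moreover have "collapse A (?g x) = x" "collapse A (?g y) = y"
      using that b y by (auto intro!: f_the_inv_into_f_bij_betw)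
    ultimately show ?thesis using that(2) collapse_less[of "?g x" A "?g y"]
      by (metis less_asym linorder_cases)
  qed
  with g show ?thesis unfolding has_order_type_iff by blast
qed

definition cofinal_map :: "('a::wellorder \<Rightarrow> 'a) \<Rightarrow> 'a \<Rightarrow> 'a \<Rightarrow> bool" where
  "cofinal_map f \<kappa> \<delta> \<longleftrightarrow> (\<forall>x<\<kappa>. f x < \<delta>) \<and> (\<forall>x<\<kappa>. \<forall>y<x. f y < f x) \<and>
     (\<forall>y<\<delta>. \<exists>x<\<kappa>. y \<le> f x)"

text \<open>The increasing continuous enumeration of a club of \<open>\<delta>\<close>; the second
  clause says that at a limit \<open>x\<close> the value \<open>f x\<close> is the supremum of the
  earlier ones.\<close>

definition normal_map :: "('a::wellorder \<Rightarrow> 'a) \<Rightarrow> 'a \<Rightarrow> 'a \<Rightarrow> bool" where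
  "normal_map f \<kappa> \<delta> \<longleftrightarrow> cofinal_map f \<kappa> \<delta> \<and>
     (\<forall>x<\<kappa>. limit_ord x \<longrightarrow> (\<forall>y<f x. \<exists>z<x. y \<le> f z))"

lemma cofinal_map_comp:
  assumes "cofinal_map g \<kappa> \<rho>" "cofinal_map f \<rho> \<delta>"
  shows "cofinal_map (\<lambda>x. f (g x)) \<kappa> \<delta>"
  unfolding cofinal_map_def
proof (intro conjI allI impI)
  fix y assume "y < \<delta>"
  then obtain x where x: "x < \<rho>" "y \<le> f x" using assms(2) by (auto simp: cofinal_map_def)
  then obtain z where z: "z < \<kappa>" "x \<le> g z" using assms(1) by (auto simp: cofinal_map_def)
  then have "g z < \<rho>" using assms(1) by (auto simp: cofinal_map_def)
  then have "f x \<le> f (g z)" using z assms(2) by (auto simp: cofinal_map_def le_less)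
  then show "\<exists>x<\<kappa>. y \<le> f (g x)" using z x by force
qed (use assms in \<open>auto simp: cofinal_map_def\<close>)

lemma cofinal_map_has_order_type:
  assumes f: "cofinal_map f \<kappa> \<delta>"
  shows "has_order_type (f ` {..<\<kappa>}) \<kappa>"
proof -
  have "inj_on f {..<\<kappa>}"
    using f unfolding cofinal_map_def by (metis inj_onI lessThan_iff less_irrefl linorder_neqE)
  then show ?thesis
    using f unfolding has_order_type_iff cofinal_map_def by (auto intro: inj_on_imp_bij_betw)
qed

lemma has_order_type_unbounded_iff:
  fixes \<delta> :: "'a::wellorder"
  shows "(\<exists>u. unbounded_in u {..<\<delta>} \<and> has_order_type u \<alpha>) \<longleftrightarrow> (\<exists>f. cofinal_map f \<alpha> \<delta>)"
proof
  assume "\<exists>u. unbounded_in u {..<\<delta>} \<and> has_order_type u \<alpha>"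
  then obtain u f where "unbounded_in u {..<\<delta>}" "bij_betw f {..<\<alpha>} u" "\<forall>x<\<alpha>. \<forall>y<x. f y < f x"
    unfolding has_order_type_iff by blast
  then have "cofinal_map f \<alpha> \<delta>"
    unfolding cofinal_map_def unbounded_in_def bij_betw_def by fastforce
  then show "\<exists>f. cofinal_map f \<alpha> \<delta>" by blast
next
  assume "\<exists>f. cofinal_map f \<alpha> \<delta>"
  then obtain f where f: "cofinal_map f \<alpha> \<delta>" ..
  then have "has_order_type (f ` {..<\<alpha>}) \<alpha>" by (rule cofinal_map_has_order_type)
  moreover have "unbounded_in (f ` {..<\<alpha>}) {..<\<delta>}"
    using f unfolding cofinal_map_def unbounded_in_def by auto
  ultimately show "\<exists>u. unbounded_in u {..<\<delta>} \<and> has_order_type u \<alpha>" by blast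
qed

lemma cf_le: "cofinal_map f \<alpha> \<delta> \<Longrightarrow> cf \<delta> \<le> \<alpha>"
  unfolding cf_def has_order_type_unbounded_iff by (rule Least_le) blast

lemma ex_cofinal_map: "\<exists>f. cofinal_map f (cf \<delta>) \<delta>"
proof -
  have "cofinal_map (\<lambda>x. x) \<delta> \<delta>" by (auto simp: cofinal_map_def)
  then show ?thesis
    unfolding cf_def has_order_type_unbounded_iff by (intro LeastI) blast
qed

lemma cofinal_map_image:
  assumes "cofinal_map f \<kappa> \<delta>"
  shows "unbounded_in (f ` {..<\<kappa>}) {..<\<delta>}"
  using assms unfolding cofinal_map_def unbounded_in_def by auto

text \<open>
  A set indexed by \<open>\<alpha>\<close> in arbitrary order has the same supremum as the subset of its
  record values, whose order type is at most \<open>\<alpha>\<close>.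
\<close>

lemma cf_le_of_unbounded:
  fixes A :: "'a::wellorder set"
  assumes A: "unbounded_in A {..<\<delta>}" and le: "|A| \<le>o |{..<\<alpha>}|"
  shows "cf \<delta> \<le> \<alpha>"
proof -
  obtain q where q: "inj_on q A" "q ` A \<subseteq> {..<\<alpha>}"
    using le card_of_ordLeq[of A "{..<\<alpha>}"] by auto
  define b where "b = the_inv_into A q"
  define R where "R = {x \<in> q ` A. \<forall>z\<in>q ` A. z < x \<longrightarrow> b z < b x}"
  have bA: "b x \<in> A" if "x \<in> q ` A" for x
    using q(1) that unfolding b_def by (auto simp: the_inv_into_f_f)
  have R: "R \<subseteq> {..<\<alpha>}" using q(2) by (auto simp: R_def)
  obtain t where t: "bij_betw t {..<collapse R \<alpha>} R" "\<forall>x<collapse R \<alpha>. \<forall>y<x. t y < t x"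
    using has_order_type_collapse[OF R] unfolding has_order_type_iff by blast
  have tR: "t x \<in> R" if "x < collapse R \<alpha>" for x
    using t(1) that by (auto simp: bij_betw_def)
  have "cofinal_map (\<lambda>x. b (t x)) (collapse R \<alpha>) \<delta>"
    unfolding cofinal_map_def
  proof (intro conjI allI impI)
    fix x assume "x < collapse R \<alpha>"
    then show "b (t x) < \<delta>" using bA tR A by (fastforce simp: R_def unbounded_in_def)
  next
    fix x y assume "x < collapse R \<alpha>" "y < x"
    then have "t y < t x" "t y \<in> R" "t x \<in> R" using t(2) tR[of x] tR[of y] by auto
    then show "b (t y) < b (t x)" unfolding R_def by blast
  next
    fix y assume "y < \<delta>"
    then obtain a where "a \<in> A" "y \<le> a" using A by (auto simp: unbounded_in_def)
    then have ex: "q a \<in> q ` A \<and> y \<le> b (q a)"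
      using q(1) by (simp add: b_def the_inv_into_f_f)
    \<comment> \<open>The least index whose value reaches \<open>y\<close> is a record, since values
      at smaller indices stay below \<open>y\<close>.\<close>
    define x where "x = (LEAST x. x \<in> q ` A \<and> y \<le> b x)"
    have x: "x \<in> q ` A \<and> y \<le> b x" unfolding x_def by (rule LeastI) (rule ex)
    have "x \<in> R"
    proof -
      have "b z < b x" if "z \<in> q ` A" "z < x" for z
        using not_less_Least[of z "\<lambda>x. x \<in> q ` A \<and> y \<le> b x"] that x unfolding x_def[symmetric]
        by auto
      then show ?thesis using x by (auto simp: R_def)
    qed
    then have "x \<in> t ` {..<collapse R \<alpha>}" using t(1) by (simp add: bij_betw_def)
    then obtain z where "z < collapse R \<alpha>" "t z = x" by auto
    then show "\<exists>x<collapse R \<alpha>. y \<le> b (t x)" using x by blast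
  qed
  then have "cf \<delta> \<le> collapse R \<alpha>" by (rule cf_le)
  also have "\<dots> \<le> \<alpha>" by (rule collapse_le)
  finally show ?thesis .
qed

section \<open>Cofinality as an initial ordinal, and its invariance under cofinal maps\<close>

lemma cf_le_self: "cf \<delta> \<le> \<delta>"
  by (rule cf_le[of "\<lambda>x. x"]) (auto simp: cofinal_map_def)

text \<open>A cofinality is an initial ordinal: an injection of it into a smaller
  \<open>\<alpha>\<close> would re-index a cofinal sequence by \<open>\<alpha>\<close>.\<close>

lemma less_cf_card:
  fixes \<delta> :: "'a::wellorder"
  assumes "\<alpha> < cf \<delta>"
  shows "|{..<\<alpha>}| <o |{..<cf \<delta>}|"
proof (rule ccontr)
  assume "\<not> ?thesis"
  then have le: "|{..<cf \<delta>}| \<le>o |{..<\<alpha>}|" by (simp add: card_of_Well_order not_ordLess_iff_ordLeq)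
  obtain f where f: "cofinal_map f (cf \<delta>) \<delta>" using ex_cofinal_map by blast
  have "cf \<delta> \<le> \<alpha>"
    by (rule cf_le_of_unbounded[OF cofinal_map_image[OF f]])
      (rule ordLeq_transitive[OF card_of_image le])
  with assms show False by simp
qed

text \<open>Collapsing an injective image inside \<open>\<kappa>\<close> gives an equinumerous
  ordinal at most \<open>\<kappa>\<close>, and the cardinalities exclude \<open>\<kappa>\<close>
  itself.\<close>

lemma card_less_of_less_initial:
  fixes A :: "'b set" and \<kappa> :: "'a::wellorder"
  assumes "|A| <o |{..<\<kappa>}|"
  shows "\<exists>\<alpha><\<kappa>. |A| =o |{..<\<alpha>}|"
proof -
  obtain q where q: "inj_on q A" "q ` A \<subseteq> {..<\<kappa>}"
    using ordLess_imp_ordLeq[OF assms] card_of_ordLeq[of A "{..<\<kappa>}"] by auto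
  have 1: "|A| =o |q ` A|" using q(1) by (meson card_of_ordIsoI inj_on_imp_bij_betw)
  have 2: "|q ` A| =o |{..<collapse (q ` A) \<kappa>}|"
    by (rule card_of_ordIsoI[OF collapse_bij_betw[OF q(2)]])
  have 3: "|A| =o |{..<collapse (q ` A) \<kappa>}|" by (rule ordIso_transitive[OF 1 2])
  have "collapse (q ` A) \<kappa> \<noteq> \<kappa>"
    using 3 assms by (metis not_ordLess_ordIso)
  then show ?thesis using 3 collapse_le[of "q ` A" \<kappa>] by (auto simp: le_less)
qed

lemma bounded_of_card_less_cf:
  fixes A :: "'a::wellorder set"
  assumes "A \<subseteq> {..<\<delta>}" "|A| <o |{..<cf \<delta>}|"
  shows "\<exists>b<\<delta>. A \<subseteq> {..<b}"
proof (rule ccontr)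
  assume neg: "\<not> ?thesis"
  have un: "unbounded_in A {..<\<delta>}"
    unfolding unbounded_in_def
  proof (intro conjI ballI)
    fix \<beta> assume "\<beta> \<in> {..<\<delta>}"
    then have "\<not> A \<subseteq> {..<\<beta>}" using neg by blast
    then show "\<exists>\<gamma>\<in>A. \<beta> \<le> \<gamma>" by (auto simp: not_less)
  qed (rule assms(1))
  obtain \<alpha> where "\<alpha> < cf \<delta>" "|A| =o |{..<\<alpha>}|" using card_less_of_less_initial[OF assms(2)] by blast
  with cf_le_of_unbounded[OF un ordIso_imp_ordLeq] show False by fastforce
qed

lemma cofinal_map_limit:
  assumes "cofinal_map f \<kappa> \<delta>" "limit_ord \<delta>"
  shows "limit_ord \<kappa>"
proof -
  have f: "\<And>x. x < \<kappa> \<Longrightarrow> f x < \<delta>" "\<And>y. y < \<delta> \<Longrightarrow> \<exists>x<\<kappa>. y \<le> f x"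
    "\<And>x y. x < \<kappa> \<Longrightarrow> y < x \<Longrightarrow> f y < f x"
    using assms(1) by (auto simp: cofinal_map_def)
  have "\<exists>\<xi>. \<beta> < \<xi> \<and> \<xi> < \<kappa>" if b: "\<beta> < \<kappa>" for \<beta>
  proof -
    obtain y where y: "f \<beta> < y" "y < \<delta>" using assms(2) f(1)[OF b] by (auto simp: limit_ord_def)
    then obtain x where x: "x < \<kappa>" "y \<le> f x" using f(2) by blast
    have "\<not> x \<le> \<beta>" using x y f(3)[OF b, of x] by (auto simp: le_less)
    with x have "\<beta> < x \<and> x < \<kappa>" by simp
    then show ?thesis ..
  qed
  moreover obtain y where "y < \<delta>" using assms(2) by (auto simp: limit_ord_def)
  then have "\<exists>x. x < \<kappa>" using f(2) by blast
  ultimately show ?thesis by (auto simp: limit_ord_def)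
qed

lemma limit_ord_cf: "limit_ord \<delta> \<Longrightarrow> limit_ord (cf \<delta>)"
  using ex_cofinal_map cofinal_map_limit by blast

lemma cofinal_map_limit':
  assumes "cofinal_map f \<kappa> \<delta>" "limit_ord \<kappa>"
  shows "limit_ord \<delta>"
proof -
  have f: "\<And>x. x < \<kappa> \<Longrightarrow> f x < \<delta>" "\<And>y. y < \<delta> \<Longrightarrow> \<exists>x<\<kappa>. y \<le> f x"
    "\<And>x y. x < \<kappa> \<Longrightarrow> y < x \<Longrightarrow> f y < f x"
    using assms(1) by (auto simp: cofinal_map_def)
  have "\<exists>\<xi>. \<beta> < \<xi> \<and> \<xi> < \<delta>" if b: "\<beta> < \<delta>" for \<beta>
  proof -
    obtain x where x: "x < \<kappa>" "\<beta> \<le> f x" using f(2)[OF b] by blast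
    then obtain x' where "x < x'" "x' < \<kappa>" using assms(2) by (auto simp: limit_ord_def)
    then have "\<beta> < f x'" "f x' < \<delta>" using f x by (auto intro: order.strict_trans1)
    then show ?thesis by blast
  qed
  moreover obtain x where "x < \<kappa>" using assms(2) by (auto simp: limit_ord_def)
  then have "\<exists>x. x < \<delta>" using f(1) by blast
  ultimately show ?thesis by (auto simp: limit_ord_def)
qed

text \<open>Composition gives one inequality. For the other, a cofinal sequence of
  \<open>\<delta>\<close> is pulled back to \<open>\<kappa>\<close>; the result need not be
  increasing, hence the appeal to \<open>cf_le_of_unbounded\<close>.\<close>

lemma cf_cofinal_map:
  assumes f: "cofinal_map f \<kappa> \<delta>" and lim: "limit_ord \<kappa>"
  shows "cf \<delta> = cf \<kappa>"
proof (rule antisym)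
  obtain g where g: "cofinal_map g (cf \<kappa>) \<kappa>" using ex_cofinal_map by blast
  have "cofinal_map (\<lambda>x. f (g x)) (cf \<kappa>) \<delta>" by (rule cofinal_map_comp[OF g f])
  then show "cf \<delta> \<le> cf \<kappa>" by (rule cf_le)
next
  obtain g where g: "cofinal_map g (cf \<delta>) \<delta>" using ex_cofinal_map by blast
  define r where "r a = (LEAST z. a \<le> f z)" for a
  have r: "a \<le> f (r a)" "r a < \<kappa>" if a: "a < \<delta>" for a
  proof -
    obtain z where z: "z < \<kappa>" "a \<le> f z" using f a by (auto simp: cofinal_map_def)
    show "a \<le> f (r a)" unfolding r_def by (rule LeastI[of _ z]) (rule z)
    have "r a \<le> z" unfolding r_def by (rule Least_le) (rule z)
    with z show "r a < \<kappa>" by simp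
  qed
  have "unbounded_in ((\<lambda>x. r (g x)) ` {..<cf \<delta>}) {..<\<kappa>}"
    unfolding unbounded_in_def
  proof (intro conjI ballI)
    show "(\<lambda>x. r (g x)) ` {..<cf \<delta>} \<subseteq> {..<\<kappa>}" using g r by (auto simp: cofinal_map_def)
    fix z assume "z \<in> {..<\<kappa>}"
    then obtain z' where z': "z < z'" "z' < \<kappa>" using lim by (auto simp: limit_ord_def)
    then have "f z' < \<delta>" using f by (auto simp: cofinal_map_def)
    then obtain x where x: "x < cf \<delta>" "f z' \<le> g x" using g by (auto simp: cofinal_map_def)
    then have "g x < \<delta>" using g by (auto simp: cofinal_map_def)
    have "z' \<le> r (g x)"
    proof (rule ccontr)
      assume "\<not> z' \<le> r (g x)"
      then have "f (r (g x)) < f z'" using f z' by (auto simp: cofinal_map_def)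
      then show False using x r(1)[OF \<open>g x < \<delta>\<close>] by auto
    qed
    then show "\<exists>\<gamma>\<in>(\<lambda>x. r (g x)) ` {..<cf \<delta>}. z \<le> \<gamma>" using x z' by force
  qed
  then show "cf \<kappa> \<le> cf \<delta>" by (rule cf_le_of_unbounded) (rule card_of_image)
qed

lemma cf_cf: "limit_ord \<delta> \<Longrightarrow> cf (cf \<delta>) = cf \<delta>"
  using cf_cofinal_map ex_cofinal_map limit_ord_cf by metis

text \<open>Passing to least strict upper bounds makes \<open>\<pi>\<close> continuous, and the
  interleaving \<open>f x \<le> \<pi> x < f y\<close> keeps it cofinal. The value \<open>f x\<close>
  depends only on \<open>\<pi>\<close> below \<open>x\<close>, which matters when sequences with a
  common initial segment are compared.\<close>

lemma normal_map_of_cofinal_map: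
  assumes \<pi>: "cofinal_map \<pi> \<kappa> \<delta>" and lim: "limit_ord \<kappa>"
  defines "f \<equiv> \<lambda>x. LEAST y. \<forall>z<x. \<pi> z < y"
  shows "normal_map f \<kappa> \<delta>" "\<And>x. x < \<kappa> \<Longrightarrow> f x \<le> \<pi> x" "\<And>x y. x < y \<Longrightarrow> y < \<kappa> \<Longrightarrow> \<pi> x < f y"
proof -
  show le: "f x \<le> \<pi> x" if "x < \<kappa>" for x
    unfolding f_def by (rule Least_le) (use \<pi> that in \<open>auto simp: cofinal_map_def\<close>)
  show gt: "\<pi> x < f y" if "x < y" "y < \<kappa>" for x y
  proof -
    have "\<forall>z<y. \<pi> z < f y" unfolding f_def
      by (rule LeastI[of _ "\<pi> y"]) (use \<pi> that in \<open>auto simp: cofinal_map_def\<close>)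
    with that show ?thesis by blast
  qed
  show "normal_map f \<kappa> \<delta>"
    unfolding normal_map_def cofinal_map_def
  proof (intro conjI allI impI)
    fix x assume "x < \<kappa>" then show "f x < \<delta>" using le \<pi> by (force simp: cofinal_map_def)
  next
    fix x y assume "x < \<kappa>" "y < x" then show "f y < f x" using le[of y] gt[of y x] by (meson order.strict_trans order.strict_trans1)
  next
    fix y assume "y < \<delta>"
    then obtain x where "x < \<kappa>" "y \<le> \<pi> x" using \<pi> by (auto simp: cofinal_map_def)
    moreover then obtain x' where "x < x'" "x' < \<kappa>" using lim by (auto simp: limit_ord_def)
    ultimately show "\<exists>x<\<kappa>. y \<le> f x" using gt[of x x'] by auto
  next
    fix x y assume x: "x < \<kappa>" "limit_ord x" "y < f x"
    then have "\<not> (\<forall>z<x. \<pi> z < y)" unfolding f_def by (auto dest: not_less_Least)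
    then obtain z where z: "z < x" "y \<le> \<pi> z" by (auto simp: not_less)
    then obtain z' where "z < z'" "z' < x" using x by (auto simp: limit_ord_def)
    then have "\<pi> z < f z'" using gt[of z z'] x by auto
    then have "y \<le> f z'" using z by auto
    then show "\<exists>z<x. y \<le> f z" using \<open>z' < x\<close> by blast
  qed
qed

lemma ex_normal_map: "limit_ord \<delta> \<Longrightarrow> \<exists>f. normal_map f (cf \<delta>) \<delta>"
  using ex_cofinal_map[of \<delta>] normal_map_of_cofinal_map(1)[OF _ limit_ord_cf] by blast

lemma normal_map_limit_restrict:
  assumes "normal_map f \<kappa> \<delta>" "x < \<kappa>" "limit_ord x"
  shows "cofinal_map f x (f x)"
  using assms unfolding normal_map_def cofinal_map_def by (meson order.strict_trans)

lemma cf_normal_map: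
  assumes "normal_map f \<kappa> \<delta>" "x < \<kappa>" "limit_ord x"
  shows "cf (f x) = cf x" "limit_ord (f x)"
  using cf_cofinal_map cofinal_map_limit' normal_map_limit_restrict[OF assms] assms(3) by blast+

subsection \<open>Clubs and stationary sets\<close>

text \<open>
  The cofinality of \<open>D\<close> exceeds \<open>|K|\<close>, stated so that it applies both to \<open>\<lambda>\<close> and to
  an ordinal \<open>\<delta> < \<lambda>\<close>.
\<close>

definition wide :: "'b set \<Rightarrow> 'a::wellorder set \<Rightarrow> bool" where
  "wide K D \<longleftrightarrow> infinite K \<and> (\<forall>z\<in>D. {..<z} \<subseteq> D) \<and>
     (\<forall>A\<subseteq>D. |A| \<le>o |K| \<longrightarrow> (\<exists>b\<in>D. A \<subseteq> {..<b}))"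

lemma wide_bound: "wide K D \<Longrightarrow> A \<subseteq> D \<Longrightarrow> |A| \<le>o |K| \<Longrightarrow> \<exists>b\<in>D. A \<subseteq> {..<b}"
  by (auto simp: wide_def)

lemma wide_less: "wide K D \<Longrightarrow> z \<in> D \<Longrightarrow> y < z \<Longrightarrow> y \<in> D"
  by (auto simp: wide_def)

lemma card_finite_less_infinite: "finite A \<Longrightarrow> infinite B \<Longrightarrow> |A| <o |B|"
  by (rule finite_ordLess_infinite[OF card_of_Well_order card_of_Well_order]) (simp_all add: Field_card_of)

lemma card_of_nat_le: "infinite K \<Longrightarrow> |range (x :: nat \<Rightarrow> _)| \<le>o |K|"
  by (metis card_of_image infinite_iff_card_of_nat ordLeq_transitive)

lemma wide_cf:
  fixes \<delta> :: "'a::wellorder"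
  assumes "infinite K" "|K| <o |{..<cf \<delta>}|"
  shows "wide K {..<\<delta>}"
  using assms bounded_of_card_less_cf[of _ \<delta>] ordLeq_ordLess_trans
  unfolding wide_def by (auto simp: Bex_def dest: order.strict_trans) blast

lemma wide_nat:
  fixes \<delta> :: "'a::wellorder"
  assumes "uncountable {..<cf \<delta>}"
  shows "wide (UNIV :: nat set) {..<\<delta>}"
proof (rule wide_cf)
  show "|UNIV :: nat set| <o |{..<cf \<delta>}|"
    using assms by (metis card_of_Well_order card_of_ordLeq countable_def not_ordLeq_iff_ordLess subset_UNIV)
qed simp

lemma wide_nonempty_above:
  assumes "wide K D" "y \<in> D" shows "\<exists>z\<in>D. y < z"
proof -
  have "|{y}| \<le>o |K|" using assms(1) by (auto simp: wide_def intro: card_of_singl_ordLeq)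
  then show ?thesis using wide_bound[of K D "{y}"] assms by auto
qed

lemma limit_of_sequence:
  fixes x :: "nat \<Rightarrow> 'a::wellorder"
  assumes mono: "\<And>n. x n < x (Suc n)" and b: "\<And>n. x n < b"
  shows "\<exists>\<gamma>. limit_ord \<gamma> \<and> \<gamma> \<le> b \<and> (\<forall>n. x n < \<gamma>) \<and> (\<forall>y<\<gamma>. \<exists>n. y \<le> x n)"
proof -
  define \<gamma> where "\<gamma> = (LEAST y. \<forall>n. x n < y)"
  have *: "x n < \<gamma>" for n
    using LeastI[of "\<lambda>y. \<forall>n. x n < y" b] b unfolding \<gamma>_def by blast
  have "\<gamma> \<le> b" unfolding \<gamma>_def by (rule Least_le) (simp add: b)
  moreover have **: "\<exists>n. y \<le> x n" if "y < \<gamma>" for y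
    using not_less_Least[of y "\<lambda>y. \<forall>n. x n < y"] that unfolding \<gamma>_def by (auto simp: not_less)
  moreover have "limit_ord \<gamma>"
    unfolding limit_ord_def
    using * ** mono by (meson order_le_less_trans)
  ultimately show ?thesis using * by blast
qed

lemma club_inI:
  assumes "C \<subseteq> D" "\<And>\<beta>. \<beta> \<in> D \<Longrightarrow> \<exists>\<gamma>\<in>C. \<beta> \<le> \<gamma>"
    "\<And>\<gamma>. \<gamma> \<in> D \<Longrightarrow> limit_ord \<gamma> \<Longrightarrow> (\<And>\<beta>. \<beta> < \<gamma> \<Longrightarrow> \<exists>z\<in>C. \<beta> \<le> z \<and> z < \<gamma>) \<Longrightarrow> \<gamma> \<in> C"
  shows "club_in C D"
  using assms unfolding club_in_def unbounded_in_def by (fastforce simp: Bex_def)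

lemma club_in_subset: "club_in C D \<Longrightarrow> C \<subseteq> D"
  by (auto simp: club_in_def unbounded_in_def)

lemma club_in_unbounded: "club_in C D \<Longrightarrow> \<beta> \<in> D \<Longrightarrow> \<exists>\<gamma>\<in>C. \<beta> \<le> \<gamma>"
  by (auto simp: club_in_def unbounded_in_def)

lemma club_in_closed:
  assumes "club_in C D" "\<gamma> \<in> D" "limit_ord \<gamma>" "\<And>\<beta>. \<beta> < \<gamma> \<Longrightarrow> \<exists>z\<in>C. \<beta> \<le> z \<and> z < \<gamma>"
  shows "\<gamma> \<in> C"
  using assms unfolding club_in_def unbounded_in_def by (fastforce simp: Bex_def)

lemma club_in_self: "club_in D D"
  by (rule club_inI) auto

lemma wide_club_next:
  assumes "wide K D" "club_in C D" "y \<in> D"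
  shows "\<exists>z\<in>C. y < z"
  using wide_nonempty_above[OF assms(1,3)] club_in_unbounded[OF assms(2)]
  by (meson order_less_le_trans)

text \<open>The common closing-off argument for limit points, intersections and closure points:
  iterate the step through \<open>\<omega>\<close> stages and take the supremum. It stays in
  \<open>D\<close> because \<open>K\<close> is infinite, so that a countable range is
  bounded.\<close>

lemma wide_iterate:
  fixes D :: "'a::wellorder set"
  assumes w: "wide K D" and \<beta>: "\<beta> \<in> D" and step: "\<And>y. y \<in> D \<Longrightarrow> \<exists>z\<in>D. y < z \<and> R y z"
  shows "\<exists>x \<gamma>. x 0 = \<beta> \<and> (\<forall>n. x n \<in> D \<and> x n < x (Suc n) \<and> R (x n) (x (Suc n))) \<and>
     \<gamma> \<in> D \<and> limit_ord \<gamma> \<and> (\<forall>n. x n < \<gamma>) \<and> (\<forall>y<\<gamma>. \<exists>n. y \<le> x n)"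
proof -
  have "\<exists>x :: nat \<Rightarrow> 'a. \<forall>n. (x n \<in> D \<and> (n = 0 \<longrightarrow> x n = \<beta>)) \<and> x n < x (Suc n) \<and> R (x n) (x (Suc n))"
    by (rule dependent_nat_choice) (use \<beta> step in auto)
  then obtain x :: "nat \<Rightarrow> 'a" where x: "x 0 = \<beta>" "\<And>n. x n \<in> D" "\<And>n. x n < x (Suc n)" "\<And>n. R (x n) (x (Suc n))"
    by auto
  have "|range x| \<le>o |K|" using w by (intro card_of_nat_le) (simp add: wide_def)
  then obtain b where b: "b \<in> D" "range x \<subseteq> {..<b}" using wide_bound[OF w, of "range x"] x(2) by auto
  then have "x n < b" for n by auto
  with limit_of_sequence[of x b] x(3)
  obtain \<gamma> where \<gamma>: "limit_ord \<gamma>" "\<gamma> \<le> b" "\<forall>n. x n < \<gamma>" "\<forall>y<\<gamma>. \<exists>n. y \<le> x n"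
    by blast
  moreover have "\<gamma> \<in> D" using \<gamma>(2) b(1) wide_less[OF w b(1), of \<gamma>] by (auto simp: le_less)
  ultimately show ?thesis using x by blast
qed

text \<open>With \<open>C\<close> equal to \<open>D\<close> this is the club of limit ordinals; in
  general it hands out points below which \<open>C\<close> is unbounded.\<close>

lemma club_in_limit_points:
  assumes w: "wide K D" and C: "club_in C D"
  shows "club_in {\<gamma> \<in> D. limit_ord \<gamma> \<and> (\<forall>\<beta><\<gamma>. \<exists>z\<in>C. \<beta> < z \<and> z < \<gamma>)} D" (is "club_in ?L D")
proof (rule club_inI)
  fix \<beta> assume "\<beta> \<in> D"
  have "\<exists>z\<in>D. y < z \<and> z \<in> C" if "y \<in> D" for y
    using wide_club_next[OF w C that] club_in_subset[OF C] by auto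
  from wide_iterate[OF w \<open>\<beta> \<in> D\<close>, of "\<lambda>y z. z \<in> C", OF this]
  obtain x \<gamma> where x: "x 0 = \<beta>" "\<forall>n. x n \<in> D \<and> x n < x (Suc n) \<and> x (Suc n) \<in> C"
    "\<gamma> \<in> D" "limit_ord \<gamma>" "\<forall>n. x n < \<gamma>" "\<forall>y<\<gamma>. \<exists>n. y \<le> x n" by blast
  have "\<exists>z\<in>C. y < z \<and> z < \<gamma>" if "y < \<gamma>" for y
    using x that by (meson order_le_less_trans)
  moreover have "\<beta> < \<gamma>" using x by metis
  ultimately show "\<exists>\<gamma>\<in>?L. \<beta> \<le> \<gamma>" using x by (intro bexI[of _ \<gamma>]) auto
next
  fix \<gamma> assume \<gamma>: "\<gamma> \<in> D" "limit_ord \<gamma>" "\<And>\<beta>. \<beta> < \<gamma> \<Longrightarrow> \<exists>z\<in>?L. \<beta> \<le> z \<and> z < \<gamma>"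
  have "\<exists>z\<in>C. \<beta> < z \<and> z < \<gamma>" if \<beta>: "\<beta> < \<gamma>" for \<beta>
  proof -
    obtain \<beta>' where \<beta>': "\<beta> < \<beta>'" "\<beta>' < \<gamma>" using \<gamma>(2) \<beta> by (auto simp: limit_ord_def)
    obtain z where z: "z \<in> ?L" "\<beta>' \<le> z" "z < \<gamma>" using \<gamma>(3)[OF \<beta>'(2)] by blast
    have "\<beta> < z" using z \<beta>' by simp
    with z obtain z' where "z' \<in> C" "\<beta> < z'" "z' < z" by blast
    with z show ?thesis by (intro bexI[of _ z']) auto
  qed
  with \<gamma> show "\<gamma> \<in> ?L" by blast
qed auto

text \<open>Each stage leaves a point of every \<open>C i\<close> between two consecutive terms, so
  the limit belongs to all of them. The factor \<open>D\<close> covers an empty \<open>I\<close>,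
  whose intersection would be \<open>UNIV\<close>.\<close>

lemma club_in_INT:
  fixes D :: "'a::wellorder set"
  assumes w: "wide K D" and I: "|I| \<le>o |K|" and C: "\<And>i. i \<in> I \<Longrightarrow> club_in (C i) D"
  shows "club_in (D \<inter> (\<Inter>i\<in>I. C i)) D"
proof (rule club_inI)
  fix \<beta> assume \<beta>: "\<beta> \<in> D"
  have "\<exists>z\<in>D. y < z \<and> (\<forall>i\<in>I. \<exists>c\<in>C i. y < c \<and> c < z)" if y: "y \<in> D" for y
  proof -
    have "\<forall>i\<in>I. \<exists>c\<in>C i. y < c" using wide_club_next[OF w C y] by blast
    then obtain c where c: "\<And>i. i \<in> I \<Longrightarrow> c i \<in> C i \<and> y < c i" by metis
    have "c ` I \<subseteq> D" using c club_in_subset[OF C] by blast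
    moreover have "|c ` I| \<le>o |K|" using card_of_image I by (rule ordLeq_transitive)
    ultimately obtain b where "b \<in> D" "c ` I \<subseteq> {..<b}" using wide_bound[OF w] by blast
    moreover obtain b' where "b' \<in> D" "y < b'" using wide_nonempty_above[OF w y] by blast
    moreover have "max b b' \<in> D" using calculation by (simp add: max_def)
    moreover have "y < c i \<and> c i < max b b' \<and> c i \<in> C i" if "i \<in> I" for i
      using c[OF that] calculation(2) that by (auto simp: less_max_iff_disj)
    moreover have "y < max b b'" using calculation by (simp add: less_max_iff_disj)
    ultimately show ?thesis by blast
  qed
  from wide_iterate[OF w \<beta>, of "\<lambda>y z. \<forall>i\<in>I. \<exists>c\<in>C i. y < c \<and> c < z", OF this]
  obtain x \<gamma> where x: "x 0 = \<beta>"
    "\<forall>n. x n \<in> D \<and> x n < x (Suc n) \<and> (\<forall>i\<in>I. \<exists>c\<in>C i. x n < c \<and> c < x (Suc n))"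
    "\<gamma> \<in> D" "limit_ord \<gamma>" "\<forall>n. x n < \<gamma>" "\<forall>y<\<gamma>. \<exists>n. y \<le> x n" by blast
  have "\<gamma> \<in> C i" if i: "i \<in> I" for i
  proof (rule club_in_closed[OF C[OF i] x(3,4)])
    fix y assume "y < \<gamma>"
    then obtain n where n: "y \<le> x n" using x by blast
    obtain c where "c \<in> C i" "x n < c" "c < x (Suc n)" using x(2) i by blast
    moreover have "x (Suc n) < \<gamma>" using x(5) by blast
    ultimately show "\<exists>z\<in>C i. y \<le> z \<and> z < \<gamma>" using n by (intro bexI[of _ c]) auto
  qed
  moreover have "\<beta> < \<gamma>" using x by metis
  ultimately show "\<exists>\<gamma>\<in>D \<inter> (\<Inter>i\<in>I. C i). \<beta> \<le> \<gamma>" using x(3) by (intro bexI[of _ \<gamma>]) auto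
next
  fix \<gamma> assume \<gamma>: "\<gamma> \<in> D" "limit_ord \<gamma>"
    "\<And>\<beta>. \<beta> < \<gamma> \<Longrightarrow> \<exists>z\<in>D \<inter> (\<Inter>i\<in>I. C i). \<beta> \<le> z \<and> z < \<gamma>"
  have "\<gamma> \<in> C i" if "i \<in> I" for i
    using club_in_closed[OF C[OF that] \<gamma>(1,2)] \<gamma>(3) that by blast
  with \<gamma> show "\<gamma> \<in> D \<inter> (\<Inter>i\<in>I. C i)" by blast
qed auto

lemma club_in_Int:
  assumes w: "wide K D" and C: "club_in C D" "club_in C' D"
  shows "club_in (C \<inter> C') D"
proof -
  have "|UNIV :: bool set| \<le>o |K|"
    using w by (intro ordLess_imp_ordLeq card_finite_less_infinite) (auto simp: wide_def)
  then have "club_in (D \<inter> (\<Inter>i\<in>UNIV. if i then C else C')) D"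
    by (rule club_in_INT[OF w]) (use C in auto)
  moreover have "D \<inter> (\<Inter>i\<in>UNIV. if i then C else C') = C \<inter> C'"
    using club_in_subset[OF C(1)] by (auto simp: all_bool_eq)
  ultimately show ?thesis by simp
qed

lemma stationary_in_mono: "stationary_in S D \<Longrightarrow> S \<subseteq> S' \<Longrightarrow> S' \<subseteq> D \<Longrightarrow> stationary_in S' D"
  by (fastforce simp: stationary_in_def)

lemma stationary_inD: "stationary_in S D \<Longrightarrow> club_in C D \<Longrightarrow> \<exists>x\<in>S. x \<in> C"
  by (auto simp: stationary_in_def)

lemma stationary_in_Int_club:
  assumes "wide K D" "stationary_in S D" "club_in C D"
  shows "stationary_in (S \<inter> C) D"
  using assms club_in_Int[OF assms(1) assms(3)] unfolding stationary_in_def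
  by (auto simp: Int_assoc)

text \<open>If each member missed a club, the intersection of these clubs would miss the union.
  Later \<open>K\<close> is a power set, which allows as many members as there are subsets.\<close>

lemma stationary_in_Union:
  assumes w: "wide K D" and F: "|F| \<le>o |K|" and S: "stationary_in (\<Union>F) D"
  shows "\<exists>A\<in>F. stationary_in A D"
proof (rule ccontr)
  assume neg: "\<not> ?thesis"
  have "\<forall>A\<in>F. \<exists>C. club_in C D \<and> A \<inter> C = {}"
    using neg S by (fastforce simp: stationary_in_def)
  then obtain C where C: "\<And>A. A \<in> F \<Longrightarrow> club_in (C A) D \<and> A \<inter> C A = {}" by metis
  have "club_in (D \<inter> (\<Inter>A\<in>F. C A)) D" by (rule club_in_INT[OF w F]) (use C in blast)
  then obtain x where "x \<in> \<Union>F" "x \<in> D \<inter> (\<Inter>A\<in>F. C A)" using stationary_inD[OF S] by blast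
  then show False using C by blast
qed

section \<open>Transfer of clubs and stationary sets along normal maps\<close>

lemma normal_mapD:
  assumes "normal_map f \<kappa> \<delta>"
  shows "\<And>x. x < \<kappa> \<Longrightarrow> f x < \<delta>" "\<And>x y. x < \<kappa> \<Longrightarrow> y < x \<Longrightarrow> f y < f x"
    "\<And>x y. x < \<kappa> \<Longrightarrow> y \<le> x \<Longrightarrow> f y \<le> f x"
    "\<And>y. y < \<delta> \<Longrightarrow> \<exists>x<\<kappa>. y \<le> f x"
    "\<And>x y. x < \<kappa> \<Longrightarrow> limit_ord x \<Longrightarrow> y < f x \<Longrightarrow> \<exists>z<x. y \<le> f z"
  using assms unfolding normal_map_def cofinal_map_def by (auto simp: le_less)

lemma normal_map_less_iff:
  assumes "normal_map f \<kappa> \<delta>" "x < \<kappa>" "y < \<kappa>"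
  shows "f x < f y \<longleftrightarrow> x < y"
  using normal_mapD(2)[OF assms(1)] assms(2,3) by (metis less_asym linorder_neqE)

text \<open>The first \<open>x\<close> with \<open>\<gamma> \<le> f x\<close> is a limit of indices
  from \<open>C\<close>, because their values approach \<open>\<gamma>\<close> from below;
  continuity at \<open>x\<close> then forbids overshooting.\<close>

lemma normal_map_hits:
  assumes f: "normal_map f \<kappa> \<delta>" and \<gamma>: "\<gamma> < \<delta>" "limit_ord \<gamma>"
    and un: "\<And>\<beta>. \<beta> < \<gamma> \<Longrightarrow> \<exists>c\<in>C. c < \<kappa> \<and> \<beta> \<le> f c \<and> f c < \<gamma>"
  shows "\<exists>x<\<kappa>. limit_ord x \<and> f x = \<gamma> \<and> (\<forall>y<x. \<exists>c\<in>C. y \<le> c \<and> c < x)"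
proof -
  define x where "x = (LEAST x. x < \<kappa> \<and> \<gamma> \<le> f x)"
  have x: "x < \<kappa> \<and> \<gamma> \<le> f x"
    unfolding x_def by (rule LeastI_ex) (use normal_mapD(4)[OF f \<gamma>(1)] in blast)
  have below: "f y < \<gamma>" if "y < x" for y
    using not_less_Least[of y "\<lambda>x. x < \<kappa> \<and> \<gamma> \<le> f x"] that x unfolding x_def[symmetric] by auto
  have step: "\<exists>c\<in>C. y < c \<and> c < x" if y: "y < x" for y
  proof -
    obtain y' where y': "f y < y'" "y' < \<gamma>" using below[OF y] \<gamma>(2) by (auto simp: limit_ord_def)
    then obtain c where c: "c \<in> C" "c < \<kappa>" "y' \<le> f c" "f c < \<gamma>" using un by blast
    have "f y < f c" "f c < f x" using y' c x by auto
    then show ?thesis using normal_map_less_iff[OF f] c x y by (intro bexI[of _ c]) auto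
  qed
  obtain \<beta> where "\<beta> < \<gamma>" using \<gamma>(2) by (auto simp: limit_ord_def)
  then obtain c where c: "c < \<kappa>" "f c < \<gamma>" using un by blast
  have "f c < f x" using c x by auto
  then have "c < x" using normal_map_less_iff[OF f] c x by auto
  then have lim: "limit_ord x" using step by (auto simp: limit_ord_def)
  have "f x = \<gamma>"
  proof (rule ccontr)
    assume "f x \<noteq> \<gamma>"
    then have "\<exists>z<x. \<gamma> \<le> f z" using normal_mapD(5)[OF f _ lim, of \<gamma>] x by auto
    then obtain z where "z < x" "\<gamma> \<le> f z" by blast
    then show False using below[of z] by simp
  qed
  then show ?thesis using x lim step by (intro exI[of _ x]) (auto simp: le_less Bex_def)
qed

lemma normal_map_image_club:
  assumes f: "normal_map f \<kappa> \<delta>" and C: "club_in C {..<\<kappa>}"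
  shows "club_in (f ` C) {..<\<delta>}"
proof (rule club_inI)
  show "f ` C \<subseteq> {..<\<delta>}" using normal_mapD(1)[OF f] club_in_subset[OF C] by auto
  fix \<beta> assume "\<beta> \<in> {..<\<delta>}"
  then obtain x where x: "x < \<kappa>" "\<beta> \<le> f x" using normal_mapD(4)[OF f] by auto
  then obtain c where c: "c \<in> C" "x \<le> c" using club_in_unbounded[OF C] by auto
  then have "f x \<le> f c" using normal_mapD(3)[OF f] club_in_subset[OF C] by auto
  then show "\<exists>\<gamma>\<in>f ` C. \<beta> \<le> \<gamma>" using x c by (intro bexI[of _ "f c"]) auto
next
  fix \<gamma> assume \<gamma>: "\<gamma> \<in> {..<\<delta>}" "limit_ord \<gamma>" "\<And>\<beta>. \<beta> < \<gamma> \<Longrightarrow> \<exists>z\<in>f ` C. \<beta> \<le> z \<and> z < \<gamma>"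
  obtain x where x: "x < \<kappa>" "limit_ord x" "f x = \<gamma>" "\<forall>y<x. \<exists>c\<in>C. y \<le> c \<and> c < x"
    using normal_map_hits[OF f _ \<gamma>(2), of C] \<gamma>(1,3) club_in_subset[OF C] by fastforce
  then have "x \<in> C" using club_in_closed[OF C, of x] by auto
  then show "\<gamma> \<in> f ` C" using x by blast
qed

lemma normal_map_preimage_stationary:
  assumes f: "normal_map f \<kappa> \<delta>" and S: "stationary_in S {..<\<delta>}"
  shows "stationary_in {x \<in> {..<\<kappa>}. f x \<in> S} {..<\<kappa>}"
  unfolding stationary_in_def
proof (intro conjI allI impI)
  fix C assume C: "club_in C {..<\<kappa>}"
  obtain y where "y \<in> S" "y \<in> f ` C" using stationary_inD[OF S normal_map_image_club[OF f C]] by blast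
  then show "{x \<in> {..<\<kappa>}. f x \<in> S} \<inter> C \<noteq> {}" using club_in_subset[OF C] by auto
qed auto

lemma normal_map_preimage_club:
  assumes f: "normal_map f \<kappa> \<delta>" and w: "wide K {..<\<delta>}" and C: "club_in C {..<\<delta>}"
  shows "club_in {x \<in> {..<\<kappa>}. f x \<in> C} {..<\<kappa>}"
proof (rule club_inI)
  fix \<beta> assume "\<beta> \<in> {..<\<kappa>}"
  then have "f \<beta> < \<delta>" using normal_mapD(1)[OF f] by auto
  \<comment> \<open>Meeting \<open>C\<close> with the range of \<open>f\<close> yields points of
    \<open>C\<close> that have an index.\<close>
  have "club_in (f ` {..<\<kappa>} \<inter> C) {..<\<delta>}"
    by (rule club_in_Int[OF w normal_map_image_club[OF f club_in_self] C])
  then obtain z where "z \<in> f ` {..<\<kappa>} \<inter> C" "f \<beta> \<le> z"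
    using club_in_unbounded[of _ _ "f \<beta>"] \<open>f \<beta> < \<delta>\<close> by blast
  then obtain x where x: "x < \<kappa>" "f x \<in> C" "f \<beta> \<le> f x" by auto
  then have "\<beta> \<le> x" using normal_map_less_iff[OF f, of x \<beta>] \<open>\<beta> \<in> {..<\<kappa>}\<close> by (auto simp: not_less[symmetric])
  then show "\<exists>\<gamma>\<in>{x \<in> {..<\<kappa>}. f x \<in> C}. \<beta> \<le> \<gamma>" using x by auto
next
  fix \<gamma> assume \<gamma>: "\<gamma> \<in> {..<\<kappa>}" "limit_ord \<gamma>"
    "\<And>\<beta>. \<beta> < \<gamma> \<Longrightarrow> \<exists>z\<in>{x \<in> {..<\<kappa>}. f x \<in> C}. \<beta> \<le> z \<and> z < \<gamma>"
  have "f \<gamma> \<in> C"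
  proof (rule club_in_closed[OF C])
    show "f \<gamma> \<in> {..<\<delta>}" using normal_mapD(1)[OF f] \<gamma>(1) by auto
    show "limit_ord (f \<gamma>)" using cf_normal_map[OF f] \<gamma> by auto
    fix y assume "y < f \<gamma>"
    then obtain z where "z < \<gamma>" "y \<le> f z" using normal_mapD(5)[OF f _ \<gamma>(2)] \<gamma>(1) by blast
    moreover then obtain z' where "z \<le> z'" "z' < \<gamma>" "f z' \<in> C" using \<gamma>(3) by blast
    ultimately show "\<exists>z\<in>C. y \<le> z \<and> z < f \<gamma>"
      using normal_mapD(2,3)[OF f] \<gamma>(1) by (intro bexI[of _ "f z'"]) (auto intro: order.trans)
  qed
  then show "\<gamma> \<in> {x \<in> {..<\<kappa>}. f x \<in> C}" using \<gamma> by auto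
qed auto

lemma limit_ord_of_uncountable_cf:
  fixes \<delta> :: "'a::wellorder"
  assumes "uncountable {..<cf \<delta>}"
  shows "limit_ord \<delta>"
proof -
  have w: "wide (UNIV :: nat set) {..<\<delta>}" by (rule wide_nat[OF assms])
  have "\<exists>z\<in>{..<\<delta>}. {} \<subseteq> {..<z}" by (rule wide_bound[OF w]) (auto simp: card_of_empty)
  moreover have "\<exists>z\<in>{..<\<delta>}. y < z" if "y < \<delta>" for y
    using wide_nonempty_above[OF w, of y] that by auto
  ultimately show ?thesis by (auto simp: limit_ord_def)
qed

text \<open>Regularity of \<open>\<tau>\<close> bounds each \<open>W z\<close>, and then all
  \<open>W x\<close> with \<open>x \<le> y\<close> at once; iterating this bound gives closure
  points.\<close>

lemma club_in_closure_points:
  fixes \<tau> :: "'a::wellorder"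
  assumes \<tau>: "cf \<tau> = \<tau>" "uncountable {..<\<tau>}"
    and W: "\<And>z. z < \<tau> \<Longrightarrow> W z \<subseteq> {..<\<tau>}" "\<And>z. z < \<tau> \<Longrightarrow> |W z| <o |{..<\<tau>}|"
  shows "club_in {\<eta> \<in> {..<\<tau>}. limit_ord \<eta> \<and> (\<forall>z<\<eta>. W z \<subseteq> {..<\<eta>})} {..<\<tau>}"
proof (rule club_inI)
  have w: "wide (UNIV :: nat set) {..<\<tau>}" using wide_nat[of \<tau>] \<tau> by simp
  have "\<exists>b<\<tau>. W z \<subseteq> {..<b}" if z: "z < \<tau>" for z
    by (rule bounded_of_card_less_cf) (use W[OF z] \<tau>(1) in auto)
  then obtain b where b: "\<And>z. z < \<tau> \<Longrightarrow> b z < \<tau> \<and> W z \<subseteq> {..<b z}" by metis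
  fix \<beta> assume "\<beta> \<in> {..<\<tau>}"
  have "\<exists>z\<in>{..<\<tau>}. y < z \<and> (\<forall>x\<le>y. W x \<subseteq> {..<z})" if y: "y \<in> {..<\<tau>}" for y
  proof -
    obtain y' where y': "y < y'" "y' < \<tau>" using wide_nonempty_above[OF w y] by auto
    have "|b ` {..<y'}| <o |{..<\<tau>}|"
      using ordLeq_ordLess_trans[OF card_of_image less_cf_card] y' \<tau>(1) by metis
    moreover have "b ` {..<y'} \<subseteq> {..<\<tau>}" using b y' by auto
    ultimately obtain c where c: "c < \<tau>" "b ` {..<y'} \<subseteq> {..<c}"
      using bounded_of_card_less_cf[of "b ` {..<y'}" \<tau>] \<tau>(1) by auto
    have "W x \<subseteq> {..<max c y'}" if x: "x \<le> y" for x
    proof -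
      have "x < y'" "x < \<tau>" using x y' by auto
      then have "b x < c" "W x \<subseteq> {..<b x}" using c b by auto
      then show ?thesis by (fastforce simp: less_max_iff_disj)
    qed
    then show ?thesis using c y' by (intro bexI[of _ "max c y'"]) (auto simp: less_max_iff_disj)
  qed
  from wide_iterate[OF w \<open>\<beta> \<in> {..<\<tau>}\<close>, of "\<lambda>y z. \<forall>x\<le>y. W x \<subseteq> {..<z}", OF this]
  obtain x \<gamma> where x: "x 0 = \<beta>"
    "\<forall>n. x n \<in> {..<\<tau>} \<and> x n < x (Suc n) \<and> (\<forall>y\<le>x n. W y \<subseteq> {..<x (Suc n)})"
    "\<gamma> \<in> {..<\<tau>}" "limit_ord \<gamma>" "\<forall>n. x n < \<gamma>" "\<forall>y<\<gamma>. \<exists>n. y \<le> x n" by blast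
  have "W y \<subseteq> {..<\<gamma>}" if y: "y < \<gamma>" for y
  proof -
    obtain n where "y \<le> x n" using x(6) y by blast
    then have "W y \<subseteq> {..<x (Suc n)}" using x(2) by blast
    also have "\<dots> \<subseteq> {..<\<gamma>}" using x(5) by (meson less_imp_le lessThan_subset_iff)
    finally show ?thesis .
  qed
  moreover have "\<beta> < \<gamma>" using x by metis
  ultimately show "\<exists>\<gamma>\<in>{\<eta> \<in> {..<\<tau>}. limit_ord \<eta> \<and> (\<forall>z<\<eta>. W z \<subseteq> {..<\<eta>})}. \<beta> \<le> \<gamma>"
    using x(3,4) by (intro bexI[of _ \<gamma>]) auto
next
  fix \<gamma> assume \<gamma>: "\<gamma> \<in> {..<\<tau>}" "limit_ord \<gamma>"
    "\<And>\<beta>. \<beta> < \<gamma> \<Longrightarrow> \<exists>z\<in>{\<eta> \<in> {..<\<tau>}. limit_ord \<eta> \<and> (\<forall>z<\<eta>. W z \<subseteq> {..<\<eta>})}. \<beta> \<le> z \<and> z < \<gamma>"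
  have "W y \<subseteq> {..<\<gamma>}" if y: "y < \<gamma>" for y
  proof -
    obtain y' where "y < y'" "y' < \<gamma>" using \<gamma>(2) y by (auto simp: limit_ord_def)
    then obtain \<eta> where \<eta>: "y' \<le> \<eta>" "\<eta> < \<gamma>" "\<forall>z<\<eta>. W z \<subseteq> {..<\<eta>}" using \<gamma>(3) by blast
    then have "W y \<subseteq> {..<\<eta>}" using \<open>y < y'\<close> by auto
    also have "\<dots> \<subseteq> {..<\<gamma>}" using \<eta> by auto
    finally show ?thesis .
  qed
  then show "\<gamma> \<in> {\<eta> \<in> {..<\<tau>}. limit_ord \<eta> \<and> (\<forall>z<\<eta>. W z \<subseteq> {..<\<eta>})}" using \<gamma> by auto
qed auto

text \<open>The functions \<open>a\<close> and \<open>b\<close> send an index of one map to an index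
  where the other has caught up. At a common closure point the earlier values interleave, so both
  continuous maps have the same supremum there.\<close>

lemma normal_maps_agree_on_club:
  fixes \<kappa> :: "'a::wellorder"
  assumes \<kappa>: "cf \<kappa> = \<kappa>" "uncountable {..<\<kappa>}"
    and f: "normal_map f \<kappa> \<delta>" and g: "normal_map g \<kappa> \<delta>"
  shows "\<exists>C. club_in C {..<\<kappa>} \<and> (\<forall>\<epsilon>\<in>C. f \<epsilon> = g \<epsilon>)"
proof -
  obtain a where a: "\<And>z. z < \<kappa> \<Longrightarrow> a z < \<kappa> \<and> f z \<le> g (a z)"
    using normal_mapD(4)[OF g normal_mapD(1)[OF f]] by metis
  obtain b where b: "\<And>z. z < \<kappa> \<Longrightarrow> b z < \<kappa> \<and> g z \<le> f (b z)"
    using normal_mapD(4)[OF f normal_mapD(1)[OF g]] by metis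
  let ?C = "{\<eta> \<in> {..<\<kappa>}. limit_ord \<eta> \<and> (\<forall>z<\<eta>. {a z, b z} \<subseteq> {..<\<eta>})}"
  have "club_in ?C {..<\<kappa>}"
  proof (rule club_in_closure_points[OF \<kappa>])
    fix z assume "z < \<kappa>"
    then show "{a z, b z} \<subseteq> {..<\<kappa>}" using a b by auto
    have "infinite {..<\<kappa>}" using \<kappa>(2) countable_finite by blast
    then show "|{a z, b z}| <o |{..<\<kappa>}|" by (intro card_finite_less_infinite) auto
  qed
  moreover have "f \<epsilon> = g \<epsilon>" if \<epsilon>: "\<epsilon> \<in> ?C" for \<epsilon>
  proof -
    have le: "p \<epsilon> \<le> q \<epsilon>" if p: "normal_map p \<kappa> \<delta>" and q: "normal_map q \<kappa> \<delta>"
      and c: "\<And>z. z < \<epsilon> \<Longrightarrow> c z < \<epsilon> \<and> p z \<le> q (c z)" for p q c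
    proof (rule ccontr)
      assume "\<not> p \<epsilon> \<le> q \<epsilon>"
      then have "\<exists>z<\<epsilon>. q \<epsilon> \<le> p z" using normal_mapD(5)[OF p, of \<epsilon> "q \<epsilon>"] \<epsilon> by auto
      then obtain z where z: "z < \<epsilon>" "q \<epsilon> \<le> p z" by blast
      then have "q \<epsilon> \<le> q (c z)" "c z < \<epsilon>" using c[of z] by auto
      then show False using normal_mapD(2)[OF q, of \<epsilon> "c z"] \<epsilon> by auto
    qed
    show ?thesis
    proof (rule antisym)
      show "f \<epsilon> \<le> g \<epsilon>" by (rule le[OF f g, of a]) (use a \<epsilon> in auto)
      show "g \<epsilon> \<le> f \<epsilon>" by (rule le[OF g f, of b]) (use b \<epsilon> in auto)
    qed
  qed
  ultimately show ?thesis by blast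
qed

subsection \<open>Club guessing and approachability\<close>

text \<open>An infinite \<open>F\<close> would contain an increasing sequence of length
  \<open>\<omega>\<close>, along which \<open>y\<close> descends forever. The proof inducts on
  \<open>y x\<close> to show that only finitely many members lie above \<open>x\<close>.\<close>

lemma finite_of_strict_antimono:
  fixes F :: "'b::wellorder set" and y :: "'b \<Rightarrow> 'a::wellorder"
  assumes anti: "\<And>x x'. x \<in> F \<Longrightarrow> x' \<in> F \<Longrightarrow> x < x' \<Longrightarrow> y x' < y x"
  shows "finite F"
proof -
  have fin: "finite (F \<inter> {x<..})" if "x \<in> F" for x
    using that
  proof (induction "y x" arbitrary: x rule: less_induct)
    case less
    show ?case
    proof (cases "F \<inter> {x<..} = {}")
      case False
      define x1 where "x1 = (LEAST z. z \<in> F \<inter> {x<..})"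
      have x1: "x1 \<in> F \<inter> {x<..}" unfolding x1_def using False by (metis LeastI ex_in_conv)
      then have "x1 \<in> F" "y x1 < y x" using anti[OF less.prems] by blast+
      then have "finite (F \<inter> {x1<..})" using less.hyps by blast
      moreover have "x1 \<le> z" if "z \<in> F \<inter> {x<..}" for z
        unfolding x1_def using that by (rule Least_le)
      then have "F \<inter> {x<..} \<subseteq> insert x1 (F \<inter> {x1<..})" by (force simp: le_less)
      ultimately show ?thesis by (meson finite_insert finite_subset)
    qed auto
  qed
  show ?thesis
  proof (cases "F = {}")
    case False
    define x1 where "x1 = (LEAST z. z \<in> F)"
    have x1: "x1 \<in> F" unfolding x1_def using False by (metis LeastI ex_in_conv)
    have "x1 \<le> z" if "z \<in> F" for z unfolding x1_def using that by (rule Least_le)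
    then have "F \<subseteq> insert x1 (F \<inter> {x1<..})" by (force simp: le_less)
    then show ?thesis using fin[OF x1] by (meson finite_insert finite_subset)
  qed auto
qed

text \<open>Pigeonhole: with only finite fibres, \<open>N\<close> would be finite or no larger than
  \<open>C\<close>.\<close>

lemma infinite_fibre:
  assumes "infinite N" "|C| <o |N|" "e ` N \<subseteq> C"
  shows "\<exists>c\<in>C. infinite {x \<in> N. e x = c}"
proof (rule ccontr)
  assume neg: "\<not> ?thesis"
  have N: "N = (\<Union>c\<in>C. {x \<in> N. e x = c})" using assms(3) by auto
  show False
  proof (cases "finite C")
    case True
    then have "finite (\<Union>c\<in>C. {x \<in> N. e x = c})" using neg by blast
    with N assms(1) show False by simp
  next
    case False
    have "|\<Union>c\<in>C. {x \<in> N. e x = c}| \<le>o |C|"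
      using neg False
      by (intro card_of_UNION_ordLeq_infinite[OF False] ballI ordLess_imp_ordLeq
          card_finite_less_infinite card_of_refl[THEN ordIso_imp_ordLeq]) blast+
    with N assms(2) show False by (metis not_ordLess_ordLeq)
  qed
qed

text \<open>The supremum \<open>m\<close> of the members up to \<open>\<epsilon>\<close>, if not
  attained, would be a limit of \<open>E\<close> and hence in \<open>E\<close>. Ordinals can thus be
  projected to a club.\<close>

lemma club_in_largest:
  fixes \<kappa> :: "'a::wellorder"
  assumes E: "club_in E {..<\<kappa>}" and \<epsilon>: "\<epsilon> < \<kappa>" and z: "z \<in> E" "z \<le> \<epsilon>"
  shows "\<exists>y\<in>E. y \<le> \<epsilon> \<and> (\<forall>z\<in>E. z \<le> \<epsilon> \<longrightarrow> z \<le> y)"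
proof -
  define m where "m = (LEAST m. \<forall>z\<in>E. z \<le> \<epsilon> \<longrightarrow> z \<le> m)"
  have m: "\<forall>z\<in>E. z \<le> \<epsilon> \<longrightarrow> z \<le> m" unfolding m_def by (rule LeastI[of _ \<epsilon>]) simp
  have le: "m \<le> \<epsilon>" unfolding m_def by (rule Least_le) simp
  have "m \<in> E"
  proof (rule ccontr)
    assume "m \<notin> E"
    have *: "\<exists>z\<in>E. \<beta> < z \<and> z < m" if \<beta>: "\<beta> < m" for \<beta>
    proof -
      have "\<not> (\<forall>z\<in>E. z \<le> \<epsilon> \<longrightarrow> z \<le> \<beta>)" using not_less_Least[of \<beta>] \<beta> unfolding m_def by blast
      then obtain z where "z \<in> E" "z \<le> \<epsilon>" "\<beta> < z" by (auto simp: not_le)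
      then show ?thesis using m \<open>m \<notin> E\<close> by (metis le_less)
    qed
    have "z < m" using m z \<open>m \<notin> E\<close> by (metis le_less)
    then have "limit_ord m" using * by (auto simp: limit_ord_def)
    then have "m \<in> E" using * le \<epsilon> by (intro club_in_closed[OF E]) (auto, meson less_imp_le)
    with \<open>m \<notin> E\<close> show False ..
  qed
  then show ?thesis using m le by blast
qed

text \<open>
  Shelah's argument: shrink a club \<open>H x\<close> along \<open>x < \<nu>\<close>, each time by a club witnessing
  that the projections of fixed cofinal sets \<open>c j\<close> to \<open>H x\<close> do not guess. At a limit
  point \<open>j \<in> X\<close> of all these clubs every step lowers the projection of some member of
  \<open>c j\<close>; as \<open>|c j| < |\<nu>|\<close>, one member is lowered infinitely often.
\<close>

lemma club_guessing:
  fixes \<kappa> \<nu> :: "'a::wellorder"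
  assumes \<kappa>: "cf \<kappa> = \<kappa>" and \<nu>: "infinite {..<\<nu>}" "|{..<\<nu>}| <o |{..<\<kappa>}|"
    and X: "stationary_in X {..<\<kappa>}" "\<And>j. j \<in> X \<Longrightarrow> |{..<cf j}| <o |{..<\<nu>}|"
  shows "\<exists>a. \<forall>E. club_in E {..<\<kappa>} \<longrightarrow> (\<exists>j\<in>X. limit_ord j \<and> unbounded_in (a j) {..<j} \<and> a j \<subseteq> E)"
proof (rule ccontr)
  assume neg: "\<not> ?thesis"
  have w: "wide {..<\<nu>} {..<\<kappa>}" by (rule wide_cf) (use \<kappa> \<nu> in auto)
  have "\<exists>u. unbounded_in u {..<j} \<and> |u| \<le>o |{..<cf j}|" for j :: 'a
    using ex_cofinal_map[of j] cofinal_map_image card_of_image by blast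
  then obtain c :: "'a \<Rightarrow> 'a set" where c: "\<And>j. unbounded_in (c j) {..<j} \<and> |c j| \<le>o |{..<cf j}|" by metis
  \<comment> \<open>The projections to \<open>E\<close> of the points of \<open>c j\<close>. For
    fixed \<open>E\<close> these sets form a candidate guessing sequence, which the assumption
    refutes by a club \<open>G E\<close>.\<close>
  define gl where "gl E j = {y\<in>E. \<exists>\<epsilon>\<in>c j. y \<le> \<epsilon> \<and> (\<forall>z\<in>E. z \<le> \<epsilon> \<longrightarrow> z \<le> y)}" for E j
  from neg have "\<forall>E. \<exists>E'. club_in E' {..<\<kappa>} \<and>
      (\<forall>j\<in>X. limit_ord j \<longrightarrow> unbounded_in (gl E j) {..<j} \<longrightarrow> \<not> gl E j \<subseteq> E')" by blast
  then obtain G where G: "\<And>E. club_in (G E) {..<\<kappa>}"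
    "\<And>E j. j \<in> X \<Longrightarrow> limit_ord j \<Longrightarrow> unbounded_in (gl E j) {..<j} \<Longrightarrow> \<not> gl E j \<subseteq> G E" by metis
  \<comment> \<open>\<open>H\<close> decreases along \<open>x\<close>, and each later stage lies in
    the club that refutes the projections to \<open>H x\<close>.\<close>
  define H where "H = wfrec {(x, y). x < y} (\<lambda>h x. {..<\<kappa>} \<inter> (\<Inter>y\<in>{..<x::'a}. G (h y)))"
  have H: "H x = {..<\<kappa>} \<inter> (\<Inter>y\<in>{..<x}. G (H y))" for x
  proof -
    have "H x = {..<\<kappa>} \<inter> (\<Inter>y\<in>{..<x}. G (cut H {(x, y). x < y} x y))"
      unfolding H_def by (subst wfrec[OF wf]) simp
    then show ?thesis by (simp add: cut_def)
  qed
  have clubH: "club_in (H x) {..<\<kappa>}" if "x \<le> \<nu>" for x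
  proof -
    have "|{..<x}| \<le>o |{..<\<nu>}|" using that by (intro card_of_mono1) auto
    then show ?thesis by (subst H) (rule club_in_INT[OF w], use G(1) in auto)
  qed
  have anti: "H x' \<subseteq> H x" if "x \<le> x'" for x x'
    using that by (subst (1 2) H) auto
  have HG: "H x' \<subseteq> G (H x)" if "x < x'" for x x'
    using that by (subst H) auto
  \<comment> \<open>Being a limit of \<open>H \<nu>\<close>, the point \<open>j\<close> is a limit
    of every earlier \<open>H x\<close>, so the projections to each of them are unbounded in
    \<open>j\<close>.\<close>
  obtain j where j: "j \<in> X" "j < \<kappa>" "limit_ord j" "\<forall>\<beta><j. \<exists>z\<in>H \<nu>. \<beta> < z \<and> z < j"
    using stationary_inD[OF X(1) club_in_limit_points[OF w clubH[of \<nu>]]] by auto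
  have "\<exists>y \<epsilon>. y \<in> H x \<and> y \<notin> G (H x) \<and> \<epsilon> \<in> c j \<and> y \<le> \<epsilon> \<and> (\<forall>z\<in>H x. z \<le> \<epsilon> \<longrightarrow> z \<le> y)"
    if x: "x < \<nu>" for x
  proof -
    have "unbounded_in (gl (H x) j) {..<j}"
      unfolding unbounded_in_def
    proof (intro conjI ballI)
      show "gl (H x) j \<subseteq> {..<j}"
        using c[of j] by (auto simp: gl_def unbounded_in_def intro: le_less_trans)
      fix \<beta> assume "\<beta> \<in> {..<j}"
      then obtain z where z: "z \<in> H \<nu>" "\<beta> < z" "z < j" using j(4) by blast
      then obtain \<epsilon> where \<epsilon>: "\<epsilon> \<in> c j" "z \<le> \<epsilon>" "\<epsilon> < j" using c[of j] by (force simp: unbounded_in_def)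
      have zx: "z \<in> H x" using anti[of x \<nu>] x z(1) less_imp_le by blast
      have "\<exists>y\<in>H x. y \<le> \<epsilon> \<and> (\<forall>z\<in>H x. z \<le> \<epsilon> \<longrightarrow> z \<le> y)"
        by (rule club_in_largest[OF clubH _ zx \<epsilon>(2)]) (use x \<epsilon> j in auto)
      then obtain y where y: "y \<in> H x" "y \<le> \<epsilon>" "\<forall>z\<in>H x. z \<le> \<epsilon> \<longrightarrow> z \<le> y" by blast
      then have "z \<le> y" using zx \<epsilon> by blast
      then have "\<beta> \<le> y" using z by auto
      then show "\<exists>\<gamma>\<in>gl (H x) j. \<beta> \<le> \<gamma>" using y \<epsilon> by (intro bexI[of _ y]) (auto simp: gl_def)
    qed
    then have "\<not> gl (H x) j \<subseteq> G (H x)" using G(2) j by blast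
    then show ?thesis unfolding gl_def by blast
  qed
  then obtain y e where ye: "\<And>x. x < \<nu> \<Longrightarrow> y x \<in> H x \<and> y x \<notin> G (H x) \<and> e x \<in> c j \<and> y x \<le> e x \<and>
      (\<forall>z\<in>H x. z \<le> e x \<longrightarrow> z \<le> y x)" by metis
  have "|c j| <o |{..<\<nu>}|" using c[of j] X(2)[OF j(1)] ordLeq_ordLess_trans by blast
  moreover have "e ` {..<\<nu>} \<subseteq> c j" using ye by auto
  ultimately obtain \<epsilon> where \<epsilon>: "infinite {x \<in> {..<\<nu>}. e x = \<epsilon>}" using infinite_fibre[OF \<nu>(1)] by blast
  have "finite {x \<in> {..<\<nu>}. e x = \<epsilon>}"
  proof (rule finite_of_strict_antimono[where y = y])
    fix x x' assume xx: "x \<in> {x \<in> {..<\<nu>}. e x = \<epsilon>}" "x' \<in> {x \<in> {..<\<nu>}. e x = \<epsilon>}" "x < x'"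
    then have "y x' \<in> H x'" "y x' \<le> e x" using ye[of x'] by auto
    then have "y x' \<in> H x" "y x' \<in> G (H x)" using anti[of x x'] HG[of x x'] xx(3) less_imp_le by blast+
    then have "y x' \<le> y x" "y x' \<noteq> y x" using ye[of x] xx \<open>y x' \<le> e x\<close> by auto
    then show "y x' < y x" by simp
  qed
  with \<epsilon> show False ..
qed

section \<open>Approachability in the successor of a regular cardinal\<close>

lemma card_UNION_less:
  fixes \<mu> z :: "'a::wellorder"
  assumes \<mu>: "cf \<mu> = \<mu>" "infinite {..<\<mu>}" and z: "z < \<mu>" "|I| \<le>o |{..<z}|"
    and A: "\<And>i. i \<in> I \<Longrightarrow> |A i| \<le>o |{..<z}|"
  shows "|\<Union>i\<in>I. A i| <o |{..<\<mu>}|"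
proof (cases "finite {..<z}")
  case True
  then have "finite (\<Union>i\<in>I. A i)" using z(2) A card_of_ordLeq_finite by (metis finite_UN_I)
  then show ?thesis using \<mu>(2) by (rule card_finite_less_infinite)
next
  case False
  have "|\<Union>i\<in>I. A i| \<le>o |{..<z}|"
    by (rule card_of_UNION_ordLeq_infinite[OF False z(2)]) (use A in blast)
  also have "|{..<z}| <o |{..<\<mu>}|" using less_cf_card[of z \<mu>] \<mu>(1) z(1) by simp
  finally (ordLeq_ordLess_trans) show ?thesis .
qed

text \<open>
  This is Shelah's \<open>S\<^sup>\<tau>\<^sub>\<kappa> \<in> I[\<tau>]\<close> for \<open>\<tau> = \<mu>\<^sup>+\<close>: an initial segment of the cofinal
  sequence of \<open>i\<close> is computed from its next term and one of \<open>\<mu>\<close> many parameters. The sets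
  \<open>a i z\<close> filter \<open>i\<close> by an injection into \<open>\<mu>\<close>; for a suitable \<open>\<zeta>\<close> the set \<open>a i \<zeta>\<close> is
  coherent, and its order type \<open>\<rho>\<close> tells which of its members to keep.
\<close>

lemma approachable_sequences:
  fixes \<kappa> \<mu> \<tau> :: "'a::wellorder"
  assumes \<mu>: "cf \<mu> = \<mu>" "uncountable {..<\<mu>}" and \<kappa>: "\<kappa> < \<mu>"
    and small: "\<And>i. i < \<tau> \<Longrightarrow> |{..<i}| \<le>o |{..<\<mu>}|"
  shows "\<exists>\<Phi>. \<forall>i<\<tau>. limit_ord i \<and> cf i = \<kappa> \<longrightarrow>
    (\<exists>\<pi> p. cofinal_map \<pi> \<kappa> i \<and> p \<in> {..<\<mu>} \<times> {..<\<mu>} \<and> (\<forall>\<epsilon><\<kappa>. \<pi> ` {..<\<epsilon>} = \<Phi> (\<pi> \<epsilon>) p))"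
proof -
  have inf: "infinite {..<\<mu>}" using \<mu>(2) countable_finite by blast
  have "\<forall>i. \<exists>h. i < \<tau> \<longrightarrow> inj_on h {..<i} \<and> h ` {..<i} \<subseteq> {..<\<mu>}"
    using small by (meson card_of_ordLeq)
  then obtain h where h: "\<And>i. i < \<tau> \<Longrightarrow> inj_on (h i) {..<i} \<and> h i ` {..<i} \<subseteq> {..<\<mu>}" by metis
  define a where "a i z = {x. x < i \<and> h i x < z}" for i z
  obtain s :: "'a \<Rightarrow> 'a \<Rightarrow> 'a" where s: "\<And>\<rho>. cofinal_map (s \<rho>) (cf \<rho>) \<rho>" using ex_cofinal_map by metis
  \<comment> \<open>The parameter pairs a filtration level with an order type. One cofinal sequence
    \<open>s \<rho>\<close> is fixed for every \<open>\<rho>\<close>, so the order type alone tells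
    which ranks to keep.\<close>
  define \<Phi> where "\<Phi> \<xi> p = {x \<in> a \<xi> (fst p). collapse (a \<xi> (fst p)) x \<in> s (snd p) ` {..<cf (snd p)}}" for \<xi> p
  have card_a: "|a i z| \<le>o |{..<z}|" if "i < \<tau>" for i z
  proof -
    have "inj_on (h i) (a i z)" using h[OF that] by (auto simp: a_def inj_on_def)
    moreover have "h i ` a i z \<subseteq> {..<z}" by (auto simp: a_def)
    ultimately show ?thesis using card_of_ordLeq by blast
  qed
  have "\<exists>\<pi> p. cofinal_map \<pi> \<kappa> i \<and> p \<in> {..<\<mu>} \<times> {..<\<mu>} \<and> (\<forall>\<epsilon><\<kappa>. \<pi> ` {..<\<epsilon>} = \<Phi> (\<pi> \<epsilon>) p)"
    if i: "i < \<tau>" "limit_ord i" "cf i = \<kappa>" for i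
  proof -
    obtain c where c: "cofinal_map c \<kappa> i" using ex_cofinal_map[of i] i(3) by auto
    have hi: "h i x < \<mu>" if "x < i" for x using h[OF i(1)] that by auto
    have ci: "c x < i" if "x < \<kappa>" for x using c that by (auto simp: cofinal_map_def)
    \<comment> \<open>The \<open>\<kappa>\<close> many values of \<open>h i\<close> on a cofinal
      sequence are bounded below the regular \<open>\<mu>\<close>, so every level from the bound on
      is cofinal in \<open>i\<close>.\<close>
    have "|(\<lambda>x. h i (c x)) ` {..<\<kappa>}| <o |{..<cf \<mu>}|"
      by (rule ordLeq_ordLess_trans[OF card_of_image less_cf_card]) (simp add: \<mu>(1) \<kappa>)
    then obtain \<zeta>0 where \<zeta>0: "\<zeta>0 < \<mu>" "(\<lambda>x. h i (c x)) ` {..<\<kappa>} \<subseteq> {..<\<zeta>0}"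
      using bounded_of_card_less_cf[of "(\<lambda>x. h i (c x)) ` {..<\<kappa>}" \<mu>] hi ci by blast
    \<comment> \<open>A limit level \<open>\<zeta>\<close> closed under \<open>W\<close> is
      coherent: the first part places the members of \<open>a i \<zeta>\<close> below
      \<open>\<xi>\<close> into \<open>a \<xi> \<zeta>\<close>, the second gives the
      converse.\<close>
    define W where "W z = (\<Union>\<xi>\<in>a i z. h \<xi> ` (a i z \<inter> {..<\<xi>})) \<union> (\<Union>\<xi>\<in>a i z. h i ` a \<xi> z)" for z
    have a_less: "\<xi> < \<tau>" if "\<xi> \<in> a i z" for \<xi> z using that i(1) by (auto simp: a_def)
    have "club_in {\<eta> \<in> {..<\<mu>}. limit_ord \<eta> \<and> (\<forall>z<\<eta>. W z \<subseteq> {..<\<eta>})} {..<\<mu>}"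
    proof (rule club_in_closure_points[OF \<mu>])
      fix z assume z: "z < \<mu>"
      show "W z \<subseteq> {..<\<mu>}"
      proof
        fix y assume "y \<in> W z"
        then consider \<xi> x where "\<xi> \<in> a i z" "x < \<xi>" "y = h \<xi> x"
          | \<xi> x where "\<xi> \<in> a i z" "x \<in> a \<xi> z" "y = h i x" unfolding W_def by blast
        then show "y \<in> {..<\<mu>}"
        proof cases
          case 1 then show ?thesis using h[OF a_less] by blast
        next
          case 2
          then have "x < i" by (auto simp: a_def)
          then show ?thesis using hi 2 by auto
        qed
      qed
      have "|\<Union>\<xi>\<in>a i z. h \<xi> ` (a i z \<inter> {..<\<xi>})| <o |{..<\<mu>}|"
        by (rule card_UNION_less[OF \<mu>(1) inf z card_a[OF i(1)]])
          (rule ordLeq_transitive[OF card_of_image ordLeq_transitive[OF card_of_mono1 card_a[OF i(1)]]], blast)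
      moreover have "|\<Union>\<xi>\<in>a i z. h i ` a \<xi> z| <o |{..<\<mu>}|"
        by (rule card_UNION_less[OF \<mu>(1) inf z card_a[OF i(1)]])
          (rule ordLeq_transitive[OF card_of_image card_a[OF a_less]])
      ultimately show "|W z| <o |{..<\<mu>}|"
        unfolding W_def using card_of_Un_ordLess_infinite[OF inf] by blast
    qed
    then obtain \<zeta> where \<zeta>: "\<zeta>0 \<le> \<zeta>" "\<zeta> < \<mu>" "limit_ord \<zeta>" "\<And>z. z < \<zeta> \<Longrightarrow> W z \<subseteq> {..<\<zeta>}"
      using club_in_unbounded[of _ "{..<\<mu>}" \<zeta>0] \<zeta>0(1) by blast
    define A where "A = a i \<zeta>"
    have Ai: "A \<subseteq> {..<i}" by (auto simp: A_def a_def)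
    have coh: "a \<xi> \<zeta> = A \<inter> {..<\<xi>}" if \<xi>: "\<xi> \<in> A" for \<xi>
    proof -
      have *: "\<exists>z<\<zeta>. v < z \<and> w < z" if "v < \<zeta>" "w < \<zeta>" for v w
      proof -
        have "max v w < \<zeta>" using that by simp
        then obtain z where "max v w < z" "z < \<zeta>" using \<zeta>(3) unfolding limit_ord_def by blast
        then show ?thesis by auto
      qed
      have \<xi>': "\<xi> < i" "h i \<xi> < \<zeta>" using \<xi> by (auto simp: A_def a_def)
      show ?thesis
      proof (intro set_eqI iffI)
        fix x assume "x \<in> a \<xi> \<zeta>"
        then have x: "x < \<xi>" "h \<xi> x < \<zeta>" by (auto simp: a_def)
        obtain z where z: "z < \<zeta>" "h \<xi> x < z" "h i \<xi> < z" using *[OF x(2) \<xi>'(2)] by blast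
        then have "\<xi> \<in> a i z" "x \<in> a \<xi> z" using x \<xi>' by (auto simp: a_def)
        then have "h i x \<in> W z" unfolding W_def by blast
        then have "h i x < \<zeta>" using \<zeta>(4)[OF z(1)] by blast
        then show "x \<in> A \<inter> {..<\<xi>}" using x \<xi>' by (auto simp: A_def a_def)
      next
        fix x assume "x \<in> A \<inter> {..<\<xi>}"
        then have x: "x < \<xi>" "x < i" "h i x < \<zeta>" by (auto simp: A_def a_def)
        obtain z where z: "z < \<zeta>" "h i x < z" "h i \<xi> < z" using *[OF x(3) \<xi>'(2)] by blast
        then have "\<xi> \<in> a i z" "x \<in> a i z \<inter> {..<\<xi>}" using x \<xi>' by (auto simp: a_def)
        then have "h \<xi> x \<in> W z" unfolding W_def by blast
        then have "h \<xi> x < \<zeta>" using \<zeta>(4)[OF z(1)] by blast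
        then show "x \<in> a \<xi> \<zeta>" using x by (auto simp: a_def)
      qed
    qed
    define \<rho> where "\<rho> = collapse A i"
    have bij: "bij_betw (collapse A) A {..<\<rho>}" unfolding \<rho>_def by (rule collapse_bij_betw[OF Ai])
    define t where "t = the_inv_into A (collapse A)"
    have tA: "t x \<in> A" "collapse A (t x) = x" if "x < \<rho>" for x
      using bij that bij_betw_the_inv_into[OF bij] unfolding t_def
      by (auto intro: f_the_inv_into_f_bij_betw simp: bij_betw_def)
    have tc: "t (collapse A x) = x" "collapse A x < \<rho>" if "x \<in> A" for x
      using bij that unfolding t_def by (auto simp: bij_betw_def the_inv_into_f_f)
    have t_mono: "t y < t x" if "x < \<rho>" "y < x" for x y
    proof (rule ccontr)
      assume "\<not> t y < t x"
      moreover have "y < \<rho>" using that by simp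
      moreover have "t y \<noteq> t x" using tA(2)[OF that(1)] tA(2)[OF \<open>y < \<rho>\<close>] that by auto
      ultimately have "collapse A (t x) < collapse A (t y)" using tA[OF that(1)] by (intro collapse_less) auto
      then show False using tA(2) that \<open>y < \<rho>\<close> by auto
    qed
    have t: "cofinal_map t \<rho> i"
      unfolding cofinal_map_def
    proof (intro conjI allI impI)
      fix y assume "y < i"
      then obtain x where x: "x < \<kappa>" "y \<le> c x" using c by (auto simp: cofinal_map_def)
      then have "h i (c x) < \<zeta>" using \<zeta>0(2) \<zeta>(1) by (auto intro: less_le_trans)
      then have "c x \<in> A" using ci x by (auto simp: A_def a_def)
      then have "collapse A (c x) < \<rho> \<and> y \<le> t (collapse A (c x))" using tc x by simp
      then show "\<exists>x<\<rho>. y \<le> t x" by blast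
    qed (use tA Ai t_mono in auto)
    have \<rho>lim: "limit_ord \<rho>" by (rule cofinal_map_limit[OF t i(2)])
    have cf\<rho>: "cf \<rho> = \<kappa>" using cf_cofinal_map[OF t \<rho>lim] i(3) by simp
    have sr: "cofinal_map (s \<rho>) \<kappa> \<rho>" using s[of \<rho>] cf\<rho> by simp
    define \<pi> where "\<pi> x = t (s \<rho> x)" for x
    have \<pi>: "cofinal_map \<pi> \<kappa> i" unfolding \<pi>_def by (rule cofinal_map_comp[OF sr t])
    have s_less: "s \<rho> x < \<rho>" if "x < \<kappa>" for x using sr that by (auto simp: cofinal_map_def)
    have \<pi>_mono: "\<pi> x < \<pi> y \<longleftrightarrow> x < y" if "x < \<kappa>" "y < \<kappa>" for x y
      using \<pi> that unfolding cofinal_map_def by (metis less_asym linorder_neqE)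
    \<comment> \<open>The order type is an admissible parameter: \<open>A\<close> injects into
      \<open>\<zeta>\<close>, which is smaller than the cardinal \<open>\<mu>\<close>.\<close>
    have "\<rho> < \<mu>"
    proof (rule ccontr)
      assume "\<not> \<rho> < \<mu>"
      then have "|{..<\<mu>}| \<le>o |{..<\<rho>}|" by (intro card_of_mono1) auto
      also have "|{..<\<rho>}| =o |A|" using card_of_ordIsoI[OF bij] by (rule ordIso_symmetric)
      also have "|A| \<le>o |{..<\<zeta>}|" unfolding A_def by (rule card_a[OF i(1)])
      finally have "|{..<\<mu>}| \<le>o |{..<\<zeta>}|" .
      moreover have "|{..<\<zeta>}| <o |{..<\<mu>}|" using less_cf_card[of \<zeta> \<mu>] \<mu>(1) \<zeta>(2) by simp
      ultimately show False by (metis not_ordLess_ordLeq)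
    qed
    moreover have "\<pi> ` {..<\<epsilon>} = \<Phi> (\<pi> \<epsilon>) (\<zeta>, \<rho>)" if \<epsilon>: "\<epsilon> < \<kappa>" for \<epsilon>
    proof -
      have \<pi>A: "\<pi> x \<in> A" if "x < \<kappa>" for x unfolding \<pi>_def using tA s_less that by blast
      \<comment> \<open>By coherence \<open>a (\<pi> \<epsilon>) \<zeta>\<close> is an initial
        segment of \<open>A\<close>, so ranks computed from \<open>\<pi> \<epsilon>\<close> and the
        parameter are the ranks in \<open>A\<close>.\<close>
      have col: "collapse (A \<inter> {..<\<pi> \<epsilon>}) x = collapse A x" if "x < \<pi> \<epsilon>" for x
        by (rule collapse_cong) (use that in auto)
      have "\<Phi> (\<pi> \<epsilon>) (\<zeta>, \<rho>) = {x \<in> A. x < \<pi> \<epsilon> \<and> collapse A x \<in> s \<rho> ` {..<\<kappa>}}"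
        unfolding \<Phi>_def using coh[OF \<pi>A[OF \<epsilon>]] col cf\<rho> by auto
      also have "\<dots> = \<pi> ` {..<\<epsilon>}"
      proof (intro set_eqI iffI)
        fix x assume "x \<in> {x \<in> A. x < \<pi> \<epsilon> \<and> collapse A x \<in> s \<rho> ` {..<\<kappa>}}"
        then obtain z where z: "x \<in> A" "x < \<pi> \<epsilon>" "z < \<kappa>" "collapse A x = s \<rho> z" by auto
        then have "x = \<pi> z" using tc(1)[of x] by (simp add: \<pi>_def)
        then show "x \<in> \<pi> ` {..<\<epsilon>}" using z \<pi>_mono \<epsilon> by auto
      next
        fix x assume "x \<in> \<pi> ` {..<\<epsilon>}"
        then obtain z where z: "z < \<epsilon>" "x = \<pi> z" by auto
        then have "z < \<kappa>" using \<epsilon> by simp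
        then show "x \<in> {x \<in> A. x < \<pi> \<epsilon> \<and> collapse A x \<in> s \<rho> ` {..<\<kappa>}}"
          using z \<pi>A \<pi>_mono \<epsilon> tA(2) s_less by (auto simp: \<pi>_def)
      qed
      finally show ?thesis ..
    qed
    ultimately show ?thesis using \<pi> \<zeta>(2) by (intro exI[of _ \<pi>] exI[of _ "(\<zeta>, \<rho>)"]) auto
  qed
  then show ?thesis by blast
qed

subsection \<open>Covered cofinal sets and reflection\<close>

text \<open>The restriction \<open>\<gamma> \<le> \<beta>\<close> leaves fewer than
  \<open>\<lambda>\<close> candidates for the segment cut at \<open>\<beta>\<close>, provided that
  each \<open>e \<gamma>\<close> has fewer than \<open>\<lambda>\<close> subsets.\<close>

definition covered :: "('a::wellorder \<Rightarrow> 'a set) \<Rightarrow> 'a set \<Rightarrow> bool" where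
  "covered e u \<longleftrightarrow> (\<forall>\<beta>\<in>u. \<exists>\<gamma>\<le>\<beta>. u \<inter> {..<\<beta>} \<subseteq> e \<gamma>)"

lemma normal_map_restrict:
  assumes "normal_map f \<kappa> \<delta>" "x < \<kappa>" "limit_ord x"
  shows "normal_map f x (f x)"
  using normal_map_limit_restrict[OF assms] normal_mapD(5)[OF assms(1)] assms(2)
  unfolding normal_map_def by (meson order.strict_trans)

lemma normal_map_comp:
  assumes k: "normal_map k \<kappa> i" and g: "normal_map g i \<delta>"
  shows "normal_map (\<lambda>x. g (k x)) \<kappa> \<delta>"
  unfolding normal_map_def
proof (intro conjI allI impI)
  show "cofinal_map (\<lambda>x. g (k x)) \<kappa> \<delta>"
    using k g cofinal_map_comp unfolding normal_map_def by blast
  fix x y assume x: "x < \<kappa>" "limit_ord x" "y < g (k x)"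
  have "k x < i" "limit_ord (k x)" using normal_mapD(1)[OF k] cf_normal_map[OF k] x by auto
  then obtain w where w: "w < k x" "y \<le> g w" using normal_mapD(5)[OF g _ _ x(3)] by blast
  then obtain z where z: "z < x" "w \<le> k z" using normal_mapD(5)[OF k x(1,2) w(1)] by blast
  have "k z < i" using normal_mapD(1)[OF k] z x(1) by (meson order.strict_trans)
  then have "g w \<le> g (k z)" using normal_mapD(3)[OF g] z by blast
  then show "\<exists>z<x. y \<le> g (k z)" using z w order.trans by blast
qed

text \<open>Used to decode a sequence from its set of values. If the maps agree before
  \<open>x\<close>, the value of either at \<open>x\<close> is attained by the other at an index not
  before \<open>x\<close>, so neither value exceeds the other.\<close>

lemma strict_mono_image_determines:
  fixes \<pi> \<pi>' :: "'a::wellorder \<Rightarrow> 'a"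
  assumes mono: "\<And>x y. x < \<epsilon> \<Longrightarrow> y < x \<Longrightarrow> \<pi> y < \<pi> x" "\<And>x y. x < \<epsilon> \<Longrightarrow> y < x \<Longrightarrow> \<pi>' y < \<pi>' x"
    and im: "\<pi> ` {..<\<epsilon>} = \<pi>' ` {..<\<epsilon>}" and x: "x < \<epsilon>"
  shows "\<pi> x = \<pi>' x"
  using x
proof (induction x rule: less_induct)
  case (less x)
  have le: "q x \<le> r x" if mq: "\<And>x y. x < \<epsilon> \<Longrightarrow> y < x \<Longrightarrow> q y < q x" and im: "r ` {..<\<epsilon>} = q ` {..<\<epsilon>}"
    and eq: "\<And>w. w < x \<Longrightarrow> q w = r w" and mr: "\<And>y. y < x \<Longrightarrow> r y < r x" for q r :: "'a \<Rightarrow> 'a"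
  proof -
    have "r x \<in> q ` {..<\<epsilon>}" using im less.prems by blast
    then obtain w where w: "w < \<epsilon>" "r x = q w" by auto
    have "\<not> w < x"
    proof
      assume "w < x"
      then have "q w < r x" using eq mr by simp
      then show False using w by simp
    qed
    then show ?thesis using w mq[of w x] by (metis less_imp_le linorder_neqE order_refl)
  qed
  have eq: "\<pi> w = \<pi>' w" if "w < x" for w using less that by auto
  show ?case
  proof (rule antisym)
    show "\<pi> x \<le> \<pi>' x" by (rule le[of \<pi> \<pi>']) (use mono im eq less.prems in auto)
    show "\<pi>' x \<le> \<pi> x"
      by (rule le[of \<pi>' \<pi>, OF mono(2) im eq[symmetric] mono(1)[OF less.prems]])
  qed
qed

text \<open>
  All \<open>\<gamma> \<in> A\<close> have uncovered points at the same set \<open>X\<close> of indices, so a single club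
  guessing sequence \<open>a\<close> on \<open>X\<close> serves all of them. If \<open>i'\<close> is the least index that looks
  like \<open>i\<close> up to \<open>x1\<close>, the part of the candidate below its next element is covered by
  \<open>e (g i')\<close>, and the club \<open>E'\<close> makes \<open>i'\<close> small enough. Only successor elements of
  \<open>a j\<close> are used, since at a limit element no gap is left for \<open>i'\<close>.
\<close>

lemma nonstationary_of_uncovered:
  fixes \<kappa> \<mu> \<nu> \<tau> \<delta> :: "'a::wellorder"
  assumes \<kappa>: "cf \<kappa> = \<kappa>" and \<nu>: "infinite {..<\<nu>}" "|{..<\<nu>}| <o |{..<\<kappa>}|"
    and \<mu>: "cf \<mu> = \<mu>" "\<kappa> < \<mu>"
    and \<tau>: "cf \<delta> = \<tau>" "|{..<\<mu>}| <o |{..<\<tau>}|" "\<And>i. i < \<tau> \<Longrightarrow> |{..<i}| \<le>o |{..<\<mu>}|"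
    and X: "stationary_in X {..<\<kappa>}" "\<And>j. j \<in> X \<Longrightarrow> |{..<cf j}| <o |{..<\<nu>}|"
    and A: "\<And>\<gamma>. \<gamma> \<in> A \<Longrightarrow> cf \<gamma> = \<kappa>" "\<And>\<gamma>. \<gamma> \<in> A \<Longrightarrow> normal_map (h \<gamma>) \<kappa> \<gamma>"
      "\<And>\<gamma>. \<gamma> \<in> A \<Longrightarrow> h \<gamma> ` {..<\<kappa>} \<subseteq> e \<gamma>"
      "\<And>\<gamma> \<epsilon> u. \<gamma> \<in> A \<Longrightarrow> \<epsilon> \<in> X \<Longrightarrow> unbounded_in u {..<h \<gamma> \<epsilon>} \<Longrightarrow> \<not> covered e u"
  shows "\<not> stationary_in (A \<inter> {..<\<delta>}) {..<\<delta>}"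
proof
  assume st: "stationary_in (A \<inter> {..<\<delta>}) {..<\<delta>}"
  have unc: "uncountable {..<x}" if "|N| <o |{..<x}|" "infinite N" for N :: "'a set" and x :: 'a
  proof
    assume "countable {..<x}"
    then have "|{..<x}| \<le>o |UNIV :: nat set|" by (meson card_of_ordLeq countable_def subset_UNIV)
    also have "|UNIV :: nat set| \<le>o |N|" using that(2) infinite_iff_card_of_nat by blast
    finally show False using that(1) by (metis not_ordLess_ordLeq)
  qed
  have unc\<kappa>: "uncountable {..<\<kappa>}" by (rule unc[OF \<nu>(2,1)])
  have "{..<\<kappa>} \<subseteq> {..<\<mu>}" using \<mu>(2) by auto
  then have unc\<mu>: "uncountable {..<\<mu>}" using unc\<kappa> countable_subset by blast
  have inf\<mu>: "infinite {..<\<mu>}" using unc\<mu> countable_finite by blast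
  have unc\<tau>: "uncountable {..<\<tau>}" by (rule unc[OF \<tau>(2) inf\<mu>])
  have lim\<delta>: "limit_ord \<delta>" by (rule limit_ord_of_uncountable_cf) (use \<tau>(1) unc\<tau> in simp)
  have cf\<tau>: "cf \<tau> = \<tau>" using cf_cf[OF lim\<delta>] \<tau>(1) by simp
  have lim\<kappa>: "limit_ord \<kappa>" by (rule limit_ord_of_uncountable_cf) (simp add: \<kappa> unc\<kappa>)
  obtain g where g: "normal_map g \<tau> \<delta>" using ex_normal_map[OF lim\<delta>] \<tau>(1) by auto
  define T where "T = {i \<in> {..<\<tau>}. g i \<in> A \<inter> {..<\<delta>}}"
  have T: "stationary_in T {..<\<tau>}" unfolding T_def by (rule normal_map_preimage_stationary[OF g st])
  \<comment> \<open>At limit indices the normal map \<open>g\<close> preserves cofinality.\<close>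
  define T' where "T' = {i. i < \<tau> \<and> limit_ord i \<and> g i \<in> A}"
  have cfT: "cf i = \<kappa>" if "i \<in> T'" for i
    using cf_normal_map(1)[OF g, of i] that A(1)[of "g i"] by (simp add: T'_def)
  have "\<exists>\<Phi>. \<forall>i<\<tau>. limit_ord i \<and> cf i = \<kappa> \<longrightarrow>
      (\<exists>\<pi> p. cofinal_map \<pi> \<kappa> i \<and> p \<in> {..<\<mu>} \<times> {..<\<mu>} \<and> (\<forall>\<epsilon><\<kappa>. \<pi> ` {..<\<epsilon>} = \<Phi> (\<pi> \<epsilon>) p))"
    by (rule approachable_sequences[OF \<mu>(1) unc\<mu> \<mu>(2)]) (rule \<tau>(3))
  then obtain \<Phi> where \<Phi>: "\<forall>i<\<tau>. limit_ord i \<and> cf i = \<kappa> \<longrightarrow>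
      (\<exists>\<pi> p. cofinal_map \<pi> \<kappa> i \<and> p \<in> {..<\<mu>} \<times> {..<\<mu>} \<and> (\<forall>\<epsilon><\<kappa>. \<pi> ` {..<\<epsilon>} = \<Phi> (\<pi> \<epsilon>) p))" ..
  have "\<forall>i. \<exists>\<pi> p. i \<in> T' \<longrightarrow> cofinal_map \<pi> \<kappa> i \<and> p \<in> {..<\<mu>} \<times> {..<\<mu>} \<and> (\<forall>\<epsilon><\<kappa>. \<pi> ` {..<\<epsilon>} = \<Phi> (\<pi> \<epsilon>) p)"
    using \<Phi> cfT unfolding T'_def by blast
  then obtain \<pi> p where \<pi>: "\<And>i. i \<in> T' \<Longrightarrow> cofinal_map (\<pi> i) \<kappa> i" and p: "\<And>i. i \<in> T' \<Longrightarrow> p i \<in> {..<\<mu>} \<times> {..<\<mu>}"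
    and \<pi>\<Phi>: "\<And>i \<epsilon>. i \<in> T' \<Longrightarrow> \<epsilon> < \<kappa> \<Longrightarrow> \<pi> i ` {..<\<epsilon>} = \<Phi> (\<pi> i \<epsilon>) (p i)" by metis
  \<comment> \<open>\<open>\<pi> i\<close> carries the approachability but need not be continuous;
    its continuous companion \<open>k i\<close> can be compared with the enumeration
    \<open>h (g i)\<close>.\<close>
  define k where "k i = (\<lambda>x. LEAST y. \<forall>z<x. \<pi> i z < y)" for i
  have k: "normal_map (k i) \<kappa> i" and k_gt: "\<And>x y. x < y \<Longrightarrow> y < \<kappa> \<Longrightarrow> \<pi> i x < k i y" if i: "i \<in> T'" for i
    using normal_map_of_cofinal_map[OF \<pi>[OF i] lim\<kappa>] unfolding k_def by blast+
  have gk: "normal_map (\<lambda>x. g (k i x)) \<kappa> (g i)" if i: "i \<in> T'" for i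
    by (rule normal_map_comp[OF k[OF i] normal_map_restrict[OF g]]) (use i in \<open>auto simp: T'_def\<close>)
  have "\<exists>C. club_in C {..<\<kappa>} \<and> (\<forall>\<epsilon>\<in>C. g (k i \<epsilon>) = h (g i) \<epsilon>)" if i: "i \<in> T'" for i
    by (rule normal_maps_agree_on_club[OF \<kappa> unc\<kappa> gk[OF i] A(2)]) (use i in \<open>auto simp: T'_def\<close>)
  then obtain E where E: "\<And>i. i \<in> T' \<Longrightarrow> club_in (E i) {..<\<kappa>}"
    "\<And>i \<epsilon>. i \<in> T' \<Longrightarrow> \<epsilon> \<in> E i \<Longrightarrow> g (k i \<epsilon>) = h (g i) \<epsilon>" by metis
  obtain a where a: "\<And>C. club_in C {..<\<kappa>} \<Longrightarrow>
      \<exists>j\<in>X. limit_ord j \<and> unbounded_in (a j) {..<j} \<and> a j \<subseteq> C"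
    using club_guessing[OF \<kappa> \<nu> X] by blast
  \<comment> \<open>This records all that a substitute for \<open>i\<close> must share: the term
    \<open>\<xi>\<close> at index \<open>\<epsilon>\<close>, the parameter \<open>q\<close>, and a
    guess that up to \<open>\<epsilon>\<close> stays where the two enumerations agree.\<close>
  define P where "P \<xi> = (\<lambda>(\<epsilon>, q, j) i. i \<in> T' \<and> \<pi> i \<epsilon> = \<xi> \<and> p i = q \<and> a j \<inter> {..\<epsilon>} \<subseteq> E i)" for \<xi>
  \<comment> \<open>There are at most \<open>\<mu>\<close> descriptions, fewer than
    \<open>\<tau>\<close>, so the least witnesses can be closed off.\<close>
  define Q where "Q = {..<\<mu>} \<times> ({..<\<mu>} \<times> {..<\<mu>}) \<times> {..<\<mu>}"
  define W where "W \<xi> = (\<lambda>r. LEAST i. P \<xi> r i) ` {r \<in> Q. \<exists>i. P \<xi> r i}" for \<xi>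
  define E' where "E' = {\<eta> \<in> {..<\<tau>}. limit_ord \<eta> \<and> (\<forall>z<\<eta>. W z \<subseteq> {..<\<eta>})}"
  have PL: "P \<xi> r (LEAST i. P \<xi> r i)" if "P \<xi> r i" for \<xi> r i using that by (rule LeastI)
  have "|{..<\<mu>} \<times> {..<\<mu>}| =o |{..<\<mu>}|" by (rule card_of_Times_same_infinite[OF inf\<mu>])
  then have "|{..<\<mu>} \<times> {..<\<mu>}| \<le>o |{..<\<mu>}|" by (rule ordIso_imp_ordLeq)
  then have Qle: "|Q| \<le>o |{..<\<mu>}|"
    unfolding Q_def
    by (intro card_of_Times_ordLeq_infinite_Field[of "|{..<\<mu>}|", unfolded Field_card_of])
      (auto simp: inf\<mu> card_of_card_order_on intro: card_of_refl[THEN ordIso_imp_ordLeq])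
  have E': "club_in E' {..<\<tau>}"
    unfolding E'_def
  proof (rule club_in_closure_points[OF cf\<tau> unc\<tau>])
    fix z
    show "W z \<subseteq> {..<\<tau>}"
    proof
      fix y assume "y \<in> W z"
      then obtain r i where "P z r i" "y = (LEAST i. P z r i)" unfolding W_def by blast
      then have "P z r y" using PL by simp
      then show "y \<in> {..<\<tau>}" by (auto simp: P_def T'_def split: prod.splits)
    qed
    have "|W z| \<le>o |Q|"
      unfolding W_def by (rule ordLeq_transitive[OF card_of_image card_of_mono1]) auto
    then show "|W z| <o |{..<\<tau>}|" using Qle \<tau>(2) ordLeq_transitive ordLeq_ordLess_trans by blast
  qed
  have w\<tau>: "wide (UNIV :: nat set) {..<\<tau>}" using wide_nat[of \<tau>] cf\<tau> unc\<tau> by simp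
  obtain i where i: "i \<in> T" "i < \<tau>" "limit_ord i" "\<forall>\<beta><i. \<exists>z\<in>E'. \<beta> < z \<and> z < i"
    using stationary_inD[OF T club_in_limit_points[OF w\<tau> E']] by auto
  have iT: "i \<in> T'" using i by (auto simp: T_def T'_def)
  have wi: "wide (UNIV :: nat set) {..<i}" by (rule wide_nat) (simp add: cfT[OF iT] unc\<kappa>)
  \<comment> \<open>Needed to pull \<open>E'\<close> back along \<open>k i\<close> to a club of
    \<open>\<kappa>\<close>, into which the guess is then made to fall.\<close>
  have "club_in (E' \<inter> {..<i}) {..<i}"
  proof (rule club_inI)
    fix \<beta> assume "\<beta> \<in> {..<i}"
    then show "\<exists>\<gamma>\<in>E' \<inter> {..<i}. \<beta> \<le> \<gamma>" using i(4) by (meson IntI lessThan_iff less_imp_le)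
  next
    fix \<gamma> assume \<gamma>: "\<gamma> \<in> {..<i}" "limit_ord \<gamma>" "\<And>\<beta>. \<beta> < \<gamma> \<Longrightarrow> \<exists>z\<in>E' \<inter> {..<i}. \<beta> \<le> z \<and> z < \<gamma>"
    have "\<gamma> \<in> E'"
    proof (rule club_in_closed[OF E' _ \<gamma>(2)])
      show "\<gamma> \<in> {..<\<tau>}" using \<gamma>(1) i(2) by auto
    qed (use \<gamma>(3) in blast)
    then show "\<gamma> \<in> E' \<inter> {..<i}" using \<gamma>(1) by blast
  qed auto
  from normal_map_preimage_club[OF k[OF iT] wi this]
  have "club_in {x \<in> {..<\<kappa>}. k i x \<in> E' \<inter> {..<i}} {..<\<kappa>}" .
  moreover have w\<kappa>: "wide (UNIV :: nat set) {..<\<kappa>}" using wide_nat[of \<kappa>] \<kappa> unc\<kappa> by simp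
  ultimately have "club_in (E i \<inter> {x \<in> {..<\<kappa>}. k i x \<in> E' \<inter> {..<i}}) {..<\<kappa>}"
    using club_in_Int E(1)[OF iT] by blast
  from a[OF this] obtain j where j: "j \<in> X" "limit_ord j" "unbounded_in (a j) {..<j}"
    "a j \<subseteq> E i" "\<And>x. x \<in> a j \<Longrightarrow> k i x \<in> E'" by blast
  have j\<kappa>: "j < \<kappa>" using j(1) X(1) by (auto simp: stationary_in_def)
  have aj: "x < j" if "x \<in> a j" for x using j(3) that by (auto simp: unbounded_in_def)
  have aj_ex: "\<exists>z\<in>a j. x \<le> z" if "x < j" for x using j(3) that by (auto simp: unbounded_in_def)
  \<comment> \<open>\<open>j\<close> is a limit of points of \<open>E i\<close>; hence the uncovered
    point \<open>h (g i) j\<close> is \<open>g (k i j)\<close>, the limit of the candidate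
    set.\<close>
  have "j \<in> E i"
  proof (rule club_in_closed[OF E(1)[OF iT] _ j(2)])
    fix \<beta> assume "\<beta> < j"
    then show "\<exists>z\<in>E i. \<beta> \<le> z \<and> z < j" using aj aj_ex j(4) by blast
  qed (use j\<kappa> in auto)
  then have hj: "h (g i) j = g (k i j)" using E(2)[OF iT] by simp
  define f where "f x = g (k i x)" for x
  have f: "normal_map f \<kappa> (g i)" unfolding f_def by (rule gk[OF iT])
  define b where "b = {x \<in> a j. \<exists>x1\<in>a j. x1 < x \<and> (\<forall>z\<in>a j. z < x \<longrightarrow> z \<le> x1)}"
  have "unbounded_in (f ` b) {..<f j}"
    unfolding unbounded_in_def
  proof (intro conjI ballI)
    show "f ` b \<subseteq> {..<f j}" using normal_mapD(2)[OF f j\<kappa>] aj by (auto simp: b_def)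
    fix y assume "y \<in> {..<f j}"
    then obtain z where z: "z < j" "y \<le> f z" using normal_mapD(5)[OF f j\<kappa> j(2)] by blast
    obtain x1 where x1: "x1 \<in> a j" "z \<le> x1" using aj_ex[OF z(1)] by blast
    obtain z' where "x1 < z'" "z' < j" using j(2) aj[OF x1(1)] unfolding limit_ord_def by blast
    then have ex: "\<exists>x. x \<in> a j \<and> x1 < x" using aj_ex[of z'] by (meson order.strict_trans1 less_le_trans)
    define x where "x = (LEAST x. x \<in> a j \<and> x1 < x)"
    have x: "x \<in> a j \<and> x1 < x" unfolding x_def using ex by (rule LeastI_ex)
    have "\<forall>z\<in>a j. z < x \<longrightarrow> z \<le> x1"
    proof (intro ballI impI)
      fix z assume "z \<in> a j" "z < x"
      then show "z \<le> x1" using not_less_Least[of z "\<lambda>x. x \<in> a j \<and> x1 < x"] unfolding x_def[symmetric] by auto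
    qed
    then have "x \<in> b" unfolding b_def using x x1 by blast
    moreover have "f z \<le> f x"
    proof (rule normal_mapD(3)[OF f])
      show "x < \<kappa>" using aj[of x] x j\<kappa> by simp
      show "z \<le> x" using x x1 by (meson le_less_trans less_imp_le)
    qed
    ultimately show "\<exists>\<gamma>\<in>f ` b. y \<le> \<gamma>" using z(2) by (meson imageI order.trans)
  qed
  moreover have "covered e (f ` b)"
    unfolding covered_def
  proof
    fix \<beta> assume "\<beta> \<in> f ` b"
    then obtain x x1 where x: "\<beta> = f x" "x \<in> a j" "x1 \<in> a j" "x1 < x" "\<forall>z\<in>a j. z < x \<longrightarrow> z \<le> x1"
      unfolding b_def by blast
    have x\<kappa>: "x < \<kappa>" "x1 < \<kappa>" using aj[of x] x j\<kappa> by auto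
    define r where "r = (x1, p i, j)"
    have Pi: "P (\<pi> i x1) r i" unfolding P_def r_def using iT j(4) by auto
    have "r \<in> Q" unfolding Q_def r_def using x\<kappa> j\<kappa> \<mu>(2) p[OF iT] by auto
    define i' where "i' = (LEAST i'. P (\<pi> i x1) r i')"
    have "i' \<in> W (\<pi> i x1)" unfolding W_def i'_def using Pi \<open>r \<in> Q\<close> by blast
    moreover have "\<pi> i x1 < k i x" by (rule k_gt[OF iT x(4) x\<kappa>(1)])
    moreover have "k i x \<in> E'" by (rule j(5)[OF x(2)])
    ultimately have "i' < k i x" unfolding E'_def by blast
    have "P (\<pi> i x1) r i'" unfolding i'_def by (rule PL[OF Pi])
    then have i': "i' \<in> T'" "\<pi> i' x1 = \<pi> i x1" "p i' = p i" "a j \<inter> {..x1} \<subseteq> E i'"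
      unfolding P_def r_def by auto
    \<comment> \<open>The set of values before \<open>x1\<close> is
      \<open>\<Phi> (\<pi> i x1) (p i)\<close>, and \<open>i'\<close> shares both arguments.\<close>
    have \<pi>eq: "\<pi> i z = \<pi> i' z" if "z < x1" for z
    proof (rule strict_mono_image_determines[OF _ _ _ that])
      show "\<pi> i ` {..<x1} = \<pi> i' ` {..<x1}" using \<pi>\<Phi>[OF iT x\<kappa>(2)] \<pi>\<Phi>[OF i'(1) x\<kappa>(2)] i' by simp
    next
      fix x y assume "x < x1" "y < x"
      then show "\<pi> i y < \<pi> i x" "\<pi> i' y < \<pi> i' x"
        using \<pi>[OF iT] \<pi>[OF i'(1)] x\<kappa>(2) by (auto simp: cofinal_map_def)
    qed
    \<comment> \<open>Agreement of the sequences strictly below \<open>x1\<close> suffices at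
      \<open>x1\<close> itself, since \<open>k\<close> takes strict upper bounds of earlier
      values.\<close>
    have keq: "k i z = k i' z" if "z \<le> x1" for z
    proof -
      have "(\<forall>w<z. \<pi> i w < y) \<longleftrightarrow> (\<forall>w<z. \<pi> i' w < y)" for y using \<pi>eq that by auto
      then show ?thesis unfolding k_def by simp
    qed
    have sub: "f ` b \<inter> {..<\<beta>} \<subseteq> e (g i')"
    proof
      fix y assume "y \<in> f ` b \<inter> {..<\<beta>}"
      then obtain z where z: "y = f z" "z \<in> a j" "f z < f x" unfolding b_def x(1) by auto
      have "z < \<kappa>" using aj[OF z(2)] j\<kappa> by simp
      then have "z < x" using normal_map_less_iff[OF f _ x\<kappa>(1)] z by blast
      \<comment> \<open>Nothing of \<open>a j\<close> lies strictly between \<open>x1\<close> and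
        \<open>x\<close>: this is what the restriction to successor elements is for.\<close>
      then have zx: "z \<le> x1" using x z by blast
      then have "z \<in> E i'" using i'(4) z(2) by blast
      then have "f z = h (g i') z" unfolding f_def keq[OF zx] by (rule E(2)[OF i'(1)])
      moreover have "h (g i') z \<in> e (g i')" using A(3)[of "g i'"] i'(1) \<open>z < \<kappa>\<close> unfolding T'_def by blast
      ultimately show "y \<in> e (g i')" using z by simp
    qed
    have "k i x < \<tau>" using normal_mapD(1)[OF k[OF iT] x\<kappa>(1)] i(2) by simp
    then have "g i' \<le> \<beta>" unfolding x(1) f_def using normal_mapD(3)[OF g] \<open>i' < k i x\<close> by simp
    with sub show "\<exists>\<gamma>\<le>\<beta>. f ` b \<inter> {..<\<beta>} \<subseteq> e \<gamma>" by blast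
  qed
  moreover have "h (g i) j = f j" using hj by (simp add: f_def)
  ultimately show False using A(4)[of "g i" j "f ` b"] iT j(1) unfolding T'_def by simp
qed

subsection \<open>Regular cardinals and the approachability ideal\<close>

lemma card_initial_less:
  assumes "regular_uncountable D" "b \<in> D" "{..<b} \<subseteq> D"
  shows "|{..<b}| <o |D|"
proof -
  have co: "Card_order (ord_rel D)" using assms(1) by (simp add: regular_uncountable_def)
  have "underS (ord_rel D) b = {..<b}" using assms(2,3) by (auto simp: underS_def ord_rel_def)
  then have "|{..<b}| <o ord_rel D" using card_of_underS[OF co, of b] assms(2) by simp
  also have "ord_rel D =o |D|" using card_of_Field_ordIso[OF co] by (simp add: ordIso_symmetric)
  finally show ?thesis .
qed

text \<open>\<open>cofinal\<close> asks for strictly larger elements, so an unbounded set is cofinal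
  once \<open>D\<close> is known to have no maximum. Regularity then gives it the full
  cardinality.\<close>

lemma bounded_in_regular:
  assumes D: "regular_uncountable D" and A: "A \<subseteq> D" "|A| <o |D|"
  shows "\<exists>b\<in>D. A \<subseteq> {..<b}"
proof (rule ccontr)
  assume neg: "\<not> ?thesis"
  have co: "Card_order (ord_rel D)" and reg: "regularCard (ord_rel D)" and inf: "infinite D"
    using D by (auto simp: regular_uncountable_def dest: countable_finite)
  have no_max: "\<exists>a'\<in>D. a < a'" if a: "a \<in> D" for a
  proof (rule ccontr)
    assume "\<not> ?thesis"
    then have "Field (ord_rel D) = under (ord_rel D) a"
      using a unfolding Field_ord_rel by (auto simp: under_def ord_rel_def not_less)
    then show False using Card_order_infinite_not_under[OF co] inf by auto
  qed
  have "cofinal A (ord_rel D)"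
    unfolding cofinal_def
  proof
    fix a assume a: "a \<in> Field (ord_rel D)"
    then obtain a' where a': "a' \<in> D" "a < a'" using no_max by auto
    then obtain b where "b \<in> A" "a' \<le> b" using neg by (meson lessThan_iff not_less subsetI)
    then show "\<exists>b\<in>A. a \<noteq> b \<and> (a, b) \<in> ord_rel D"
      using a a' A(1) unfolding Field_ord_rel by (intro bexI[of _ b]) (auto simp: ord_rel_def)
  qed
  then have "|A| =o ord_rel D" using reg A(1) by (simp add: regularCard_def)
  also have "ord_rel D =o |D|" using card_of_Field_ordIso[OF co] by (simp add: ordIso_symmetric)
  finally (ordIso_transitive) show False using A(2) not_ordLess_ordIso by blast
qed

lemma wide_UNIV:
  assumes "regular_uncountable (UNIV :: 'a::wellorder set)" "infinite K" "|K| <o |UNIV :: 'a set|"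
  shows "wide K (UNIV :: 'a set)"
  unfolding wide_def
proof (intro conjI allI impI)
  fix A :: "'a set" assume "|A| \<le>o |K|"
  then have "|A| <o |UNIV :: 'a set|" using assms(3) by (rule ordLeq_ordLess_trans)
  then show "\<exists>b\<in>UNIV. A \<subseteq> {..<b}" using bounded_in_regular[OF assms(1), of A] by simp
qed (use assms(2) in auto)

lemma cf_regular_uncountable:
  assumes "regular_uncountable {..<\<theta>}"
  shows "cf \<theta> = \<theta>"
proof (rule antisym[OF cf_le_self], rule ccontr)
  assume "\<not> \<theta> \<le> cf \<theta>"
  then have l: "cf \<theta> < \<theta>" by simp
  obtain f where f: "cofinal_map f (cf \<theta>) \<theta>" using ex_cofinal_map by blast
  have "|f ` {..<cf \<theta>}| <o |{..<\<theta>}|"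
    by (rule ordLeq_ordLess_trans[OF card_of_image card_initial_less[OF assms]]) (use l in auto)
  moreover have "f ` {..<cf \<theta>} \<subseteq> {..<\<theta>}" using f by (auto simp: cofinal_map_def)
  ultimately obtain b where "b < \<theta>" "f ` {..<cf \<theta>} \<subseteq> {..<b}"
    using bounded_in_regular[OF assms] by blast
  moreover obtain x where "x < cf \<theta>" "b \<le> f x" using f \<open>b < \<theta>\<close> by (auto simp: cofinal_map_def)
  ultimately show False by auto
qed

text \<open>The ordinal \<open>\<nu>\<close> guarantees that the \<open>LEAST\<close> in
  \<open>card_succ\<close> is attained. A shorter cofinal sequence would exhibit the successor as a
  union of at most \<open>\<kappa>\<close> many sets of size at most
  \<open>\<kappa>\<close>.\<close>

lemma card_succ_properties:
  fixes \<kappa> \<nu> :: "'a::wellorder"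
  assumes inf: "infinite {..<\<kappa>}" and \<nu>: "|{..<\<kappa>}| <o |{..<\<nu>}|"
  shows "|{..<\<kappa>}| <o |{..<card_succ \<kappa>}|"
    "\<And>\<alpha>. \<alpha> < card_succ \<kappa> \<Longrightarrow> |{..<\<alpha>}| \<le>o |{..<\<kappa>}|"
    "cf (card_succ \<kappa>) = card_succ \<kappa>"
proof -
  let ?\<mu> = "card_succ \<kappa>"
  show 1: "|{..<\<kappa>}| <o |{..<?\<mu>}|" unfolding card_succ_def using \<nu> by (rule LeastI)
  show 2: "|{..<\<alpha>}| \<le>o |{..<\<kappa>}|" if "\<alpha> < ?\<mu>" for \<alpha>
    using not_less_Least[of \<alpha> "\<lambda>\<mu>. |{..<\<kappa>}| <o |{..<\<mu>}|"] that
    unfolding card_succ_def by (simp add: card_of_Well_order not_ordLess_iff_ordLeq)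
  show "cf ?\<mu> = ?\<mu>"
  proof (rule antisym[OF cf_le_self], rule ccontr)
    assume "\<not> ?\<mu> \<le> cf ?\<mu>"
    then have l: "cf ?\<mu> < ?\<mu>" by simp
    obtain f where f: "cofinal_map f (cf ?\<mu>) ?\<mu>" using ex_cofinal_map by blast
    have "|{..f x}| \<le>o |{..<\<kappa>}|" if x: "x < cf ?\<mu>" for x
    proof -
      have "f x < ?\<mu>" using f x by (auto simp: cofinal_map_def)
      then have "|{..<f x}| \<le>o |{..<\<kappa>}|" by (rule 2)
      moreover have "|{f x}| \<le>o |{..<\<kappa>}|"
        using inf by (intro ordLess_imp_ordLeq card_finite_less_infinite) auto
      ultimately have "|{..<f x} \<union> {f x}| \<le>o |{..<\<kappa>}|"
        using inf by (intro card_of_Un_ordLeq_infinite_Field) (auto simp: Field_card_of card_of_card_order_on)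
      moreover have "{..<f x} \<union> {f x} = {..f x}" by auto
      ultimately show ?thesis by simp
    qed
    then have "|\<Union>x\<in>{..<cf ?\<mu>}. {..f x}| \<le>o |{..<\<kappa>}|"
      using 2[OF l] inf by (intro card_of_UNION_ordLeq_infinite) auto
    moreover have "{..<?\<mu>} \<subseteq> (\<Union>x\<in>{..<cf ?\<mu>}. {..f x})" using f by (auto simp: cofinal_map_def)
    ultimately have "|{..<?\<mu>}| \<le>o |{..<\<kappa>}|" using card_of_mono1 ordLeq_transitive by blast
    with 1 show False by (metis not_ordLess_ordLeq)
  qed
qed

text \<open>Along a normal sequence of length \<open>cf \<delta>\<close>, the set contains the value
  at some limit index \<open>x\<close>, and its cofinality is
  \<open>cf x \<le> x < cf \<delta>\<close>.\<close>

lemma cf_less_of_reflects_in: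
  fixes \<delta> :: "'a::wellorder"
  assumes S: "S \<subseteq> S_cof \<kappa>" and r: "reflects_in S \<delta>"
  shows "\<kappa> < cf \<delta>"
proof -
  have unc: "uncountable {..<cf \<delta>}" and st: "stationary_in (S \<inter> {..<\<delta>}) {..<\<delta>}"
    using r by (auto simp: reflects_in_def)
  have lim: "limit_ord \<delta>" by (rule limit_ord_of_uncountable_cf[OF unc])
  obtain f where f: "normal_map f (cf \<delta>) \<delta>" using ex_normal_map[OF lim] by blast
  have w: "wide (UNIV :: nat set) {..<cf \<delta>}" using wide_nat[of "cf \<delta>"] cf_cf[OF lim] unc by simp
  obtain x where x: "x < cf \<delta>" "f x \<in> S" "limit_ord x"
    using stationary_inD[OF normal_map_preimage_stationary[OF f st] club_in_limit_points[OF w club_in_self]]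
    by auto
  have "\<kappa> = cf x" using cf_normal_map(1)[OF f x(1,3)] x(2) S by (auto simp: S_cof_def)
  with x(1) show ?thesis using cf_le_self[of x] by simp
qed

text \<open>Transitivity of reflection: \<open>C\<close> is a club in any of its limit points, and
  in one that lies in \<open>S'\<close> the set \<open>S\<close> meets it.\<close>

lemma stationary_trace:
  fixes \<delta> :: "'a::wellorder"
  assumes unc: "uncountable {..<cf \<delta>}"
    and st: "stationary_in (S' \<inter> {..<\<delta>}) {..<\<delta>}"
    and S': "\<And>\<gamma>. \<gamma> \<in> S' \<Longrightarrow> stationary_in (S \<inter> {..<\<gamma>}) {..<\<gamma>}"
  shows "stationary_in (S \<inter> {..<\<delta>}) {..<\<delta>}"
  unfolding stationary_in_def
proof (intro conjI allI impI)
  fix C assume C: "club_in C {..<\<delta>}"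
  obtain \<gamma> where \<gamma>: "\<gamma> \<in> S'" "\<gamma> < \<delta>" "limit_ord \<gamma>" "\<forall>\<beta><\<gamma>. \<exists>z\<in>C. \<beta> < z \<and> z < \<gamma>"
    using stationary_inD[OF st club_in_limit_points[OF wide_nat[OF unc] C]] by auto
  have "club_in (C \<inter> {..<\<gamma>}) {..<\<gamma>}"
  proof (rule club_inI)
    fix \<beta> assume "\<beta> \<in> {..<\<gamma>}"
    then show "\<exists>z\<in>C \<inter> {..<\<gamma>}. \<beta> \<le> z" using \<gamma>(4) by (meson IntI lessThan_iff less_imp_le)
  next
    fix z assume z: "z \<in> {..<\<gamma>}" "limit_ord z" "\<And>\<beta>. \<beta> < z \<Longrightarrow> \<exists>y\<in>C \<inter> {..<\<gamma>}. \<beta> \<le> y \<and> y < z"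
    have "z \<in> C"
    proof (rule club_in_closed[OF C _ z(2)])
      show "z \<in> {..<\<delta>}" using z(1) \<gamma>(2) by auto
    qed (use z(3) in blast)
    then show "z \<in> C \<inter> {..<\<gamma>}" using z(1) by blast
  qed auto
  then obtain x where "x \<in> S \<inter> {..<\<gamma>}" "x \<in> C" using stationary_inD[OF S'[OF \<gamma>(1)]] by blast
  then show "S \<inter> {..<\<delta>} \<inter> C \<noteq> {}" using \<gamma>(2) by auto
qed auto

section \<open>Covered ordinals form a set in the ideal\<close>

lemma ex_cofinal_map_into:
  fixes \<delta> :: "'a::wellorder"
  assumes u: "unbounded_in u {..<\<delta>}" and lim: "limit_ord \<delta>"
  shows "\<exists>f. cofinal_map f (cf \<delta>) \<delta> \<and> f ` {..<cf \<delta>} \<subseteq> u"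
proof -
  have sub: "u \<subseteq> {..<\<delta>}" using u by (auto simp: unbounded_in_def)
  obtain t where t: "bij_betw t {..<collapse u \<delta>} u" "\<forall>x<collapse u \<delta>. \<forall>y<x. t y < t x"
    using has_order_type_collapse[OF sub] unfolding has_order_type_iff by blast
  have im: "t ` {..<collapse u \<delta>} = u" using t(1) by (simp add: bij_betw_def)
  have ct: "cofinal_map t (collapse u \<delta>) \<delta>"
    unfolding cofinal_map_def
  proof (intro conjI allI impI)
    fix y assume "y < \<delta>"
    then obtain z where z: "z \<in> u" "y \<le> z" using u by (auto simp: unbounded_in_def)
    then have "z \<in> t ` {..<collapse u \<delta>}" using im by simp
    then show "\<exists>x<collapse u \<delta>. y \<le> t x" using z by auto
  qed (use t(2) im sub in auto)
  have limc: "limit_ord (collapse u \<delta>)" by (rule cofinal_map_limit[OF ct lim])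
  obtain s where s: "cofinal_map s (cf \<delta>) (collapse u \<delta>)"
    using ex_cofinal_map[of "collapse u \<delta>"] cf_cofinal_map[OF ct limc] by auto
  have "t (s x) \<in> u" if "x < cf \<delta>" for x
  proof -
    have "s x < collapse u \<delta>" using s that by (simp add: cofinal_map_def)
    then have "t (s x) \<in> t ` {..<collapse u \<delta>}" by simp
    then show ?thesis using im by simp
  qed
  then have "(\<lambda>x. t (s x)) ` {..<cf \<delta>} \<subseteq> u" by auto
  then show ?thesis using cofinal_map_comp[OF s ct] by blast
qed

lemma covered_mono: "covered e u \<Longrightarrow> v \<subseteq> u \<Longrightarrow> covered e v"
  unfolding covered_def by (meson Int_mono dual_order.refl subset_iff)

lemma card_UNION_less_UNIV:
  fixes B :: "'a::wellorder \<Rightarrow> 'b set"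
  assumes reg: "regular_uncountable (UNIV :: 'a set)"
    and B: "\<And>\<gamma>. |B \<gamma>| <o |UNIV :: 'a set|" and \<theta>: "infinite {..<\<theta>::'a}"
  shows "|\<Union>\<gamma>\<in>{..\<alpha>}. B \<gamma>| <o |UNIV :: 'a set|"
proof -
  have "\<exists>b. |B \<gamma>| \<le>o |{..<b::'a}|" for \<gamma>
  proof -
    obtain q where q: "inj_on q (B \<gamma>)" "q ` B \<gamma> \<subseteq> (UNIV :: 'a set)"
      using ordLess_imp_ordLeq[OF B[of \<gamma>]] card_of_ordLeq[of "B \<gamma>" "UNIV :: 'a set"] by blast
    have "|q ` B \<gamma>| <o |UNIV :: 'a set|" by (rule ordLeq_ordLess_trans[OF card_of_image B])
    then obtain b where "q ` B \<gamma> \<subseteq> {..<b}" using bounded_in_regular[OF reg] by blast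
    then show ?thesis using q(1) card_of_ordLeq by blast
  qed
  then obtain b :: "'a \<Rightarrow> 'a" where b: "\<And>\<gamma>. |B \<gamma>| \<le>o |{..<b \<gamma>}|" by metis
  have init: "|{..<x}| <o |UNIV :: 'a set|" for x :: 'a by (rule card_initial_less[OF reg]) auto
  have "\<exists>c. {\<alpha>} \<subseteq> {..<c}"
    using bounded_in_regular[OF reg, of "{\<alpha>}"] reg
    by (auto simp: regular_uncountable_def intro!: card_finite_less_infinite dest: countable_finite)
  then obtain c where c: "\<alpha> < c" by auto
  have "|b ` {..<c}| <o |UNIV :: 'a set|" by (rule ordLeq_ordLess_trans[OF card_of_image init])
  then obtain d where d: "b ` {..<c} \<subseteq> {..<d}" using bounded_in_regular[OF reg, of "b ` {..<c}"] by auto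
  \<comment> \<open>One ordinal bounds the index set and all the sizes; including
    \<open>\<theta>\<close> makes it infinite, as the bound on unions requires.\<close>
  define m where "m = max \<theta> (max c d)"
  have mono: "|{..<x}| \<le>o |{..<m}|" if "x \<le> m" for x using that by (intro card_of_mono1) auto
  have "infinite {..<m}" using \<theta> by (rule contrapos_nn) (rule finite_subset, auto simp: m_def)
  then have "|\<Union>\<gamma>\<in>{..\<alpha>}. B \<gamma>| \<le>o |{..<m}|"
  proof (rule card_of_UNION_ordLeq_infinite)
    have "{..\<alpha>} \<subseteq> {..<m}" using c by (auto simp: m_def less_max_iff_disj)
    then show "|{..\<alpha>}| \<le>o |{..<m}|" by (rule card_of_mono1)
    show "\<forall>\<gamma>\<in>{..\<alpha>}. |B \<gamma>| \<le>o |{..<m}|"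
    proof
      fix \<gamma> assume "\<gamma> \<in> {..\<alpha>}"
      then have "b \<gamma> \<in> {..<d}" using c d by (intro subsetD[OF d] imageI) auto
      then have "b \<gamma> \<le> m" by (auto simp: m_def le_max_iff_disj)
      then show "|B \<gamma>| \<le>o |{..<m}|" using b mono ordLeq_transitive by blast
    qed
  qed
  then show ?thesis using init ordLeq_ordLess_trans by blast
qed

text \<open>Traces at \<open>\<alpha>\<close> are drawn from the power sets of
  \<open>e \<gamma>\<close> with \<open>\<gamma> \<le> \<alpha>\<close>, fewer than
  \<open>\<lambda>\<close> in all. A cofinal set itself need lie in no single
  \<open>e \<gamma>\<close>, so one chosen witness per ordinal is added.\<close>

lemma covered_in_I_check:
  fixes e :: "'a::wellorder \<Rightarrow> 'a set"
  assumes reg: "regular_uncountable (UNIV :: 'a set)" and \<theta>: "uncountable {..<\<theta>}"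
    and e: "\<And>\<gamma>. |Pow (e \<gamma>)| <o |UNIV :: 'a set|"
  shows "{\<delta> \<in> S_cof \<theta>. \<exists>u. unbounded_in u {..<\<delta>} \<and> covered e u} \<in> I_check \<theta>"
proof -
  have inf: "infinite {..<\<theta>}" and infU: "infinite (UNIV :: 'a set)"
    using \<theta> reg by (auto simp: regular_uncountable_def dest: countable_finite)
  have small: "|x| <o |UNIV :: 'a set|" if "x \<subseteq> {..<\<alpha>}" for x :: "'a set" and \<alpha>
    using ordLeq_ordLess_trans[OF card_of_mono1[OF that] card_initial_less[OF reg]] by auto
  define G where "G \<delta> v \<longleftrightarrow> unbounded_in v {..<\<delta>} \<and> has_order_type v \<theta> \<and> covered e v" for \<delta> v
  \<comment> \<open>The default \<open>{}\<close> is covered, so every \<open>v \<delta>\<close> is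
    fit for a system whether or not a witness exists.\<close>
  define v where "v \<delta> = (if \<exists>v. G \<delta> v then SOME v. G \<delta> v else {})" for \<delta>
  have vG: "G \<delta> (v \<delta>)" if "G \<delta> x" for \<delta> x using that unfolding v_def by (auto intro: someI2)
  have "v \<delta> = {} \<or> G \<delta> (v \<delta>)" for \<delta> using vG[of \<delta>] by (cases "\<exists>v. G \<delta> v") (auto simp: v_def)
  moreover have "covered e {}" by (simp add: covered_def)
  ultimately have v_sub: "v \<delta> \<subseteq> {..<\<delta>}" and v_cov: "covered e (v \<delta>)" for \<delta>
    unfolding G_def unbounded_in_def by (metis empty_subsetI)+
  define P where "P \<alpha> = insert (v \<alpha>) {x. x \<subseteq> {..<\<alpha>} \<and> covered e x \<and> (\<exists>\<gamma>\<le>\<alpha>. x \<subseteq> e \<gamma>)}" for \<alpha>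
  have Pa: "a \<subseteq> {..<\<alpha>} \<and> covered e a" if "a \<in> P \<alpha>" for a \<alpha> using that v_sub v_cov by (auto simp: P_def)
  have restr: "a \<inter> {..<\<beta>} \<in> P \<beta>" if "covered e a" "\<beta> \<in> a" for a \<beta>
    using that covered_mono[OF that(1), of "a \<inter> {..<\<beta>}"] unfolding P_def covered_def by blast
  have "small_system P"
    unfolding small_system_def
  proof (intro allI conjI ballI)
    fix \<alpha>
    have "P \<alpha> \<subseteq> {v \<alpha>} \<union> (\<Union>\<gamma>\<in>{..\<alpha>}. Pow (e \<gamma>))" unfolding P_def by auto
    moreover have "|{v \<alpha>} \<union> (\<Union>\<gamma>\<in>{..\<alpha>}. Pow (e \<gamma>))| <o |UNIV :: 'a set|"
      by (rule card_of_Un_ordLess_infinite[OF infU card_finite_less_infinite[OF _ infU]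
            card_UNION_less_UNIV[OF reg e inf]]) simp
    ultimately show "|P \<alpha>| <o |UNIV :: 'a set|" by (rule ordLeq_ordLess_trans[OF card_of_mono1])
    fix a assume "a \<in> P \<alpha>"
    then show "a \<subseteq> {..<\<alpha>}" "|a| <o |UNIV :: 'a set|" using Pa[of a \<alpha>] small[of a \<alpha>] by auto
    show "a \<inter> {..<\<beta>} \<in> P \<beta>" if "\<beta> \<in> a" for \<beta> using Pa[OF \<open>a \<in> P \<alpha>\<close>] restr that by simp
  qed
  moreover have "{\<delta> \<in> S_cof \<theta>. \<exists>u. unbounded_in u {..<\<delta>} \<and> covered e u} \<inter> UNIV \<subseteq> good'' \<theta> P"
  proof
    fix \<delta> assume "\<delta> \<in> {\<delta> \<in> S_cof \<theta>. \<exists>u. unbounded_in u {..<\<delta>} \<and> covered e u} \<inter> UNIV"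
    then obtain u where u: "cf \<delta> = \<theta>" "unbounded_in u {..<\<delta>}" "covered e u" by (auto simp: S_cof_def)
    have lim: "limit_ord \<delta>" by (rule limit_ord_of_uncountable_cf) (simp add: u \<theta>)
    obtain f where f: "cofinal_map f \<theta> \<delta>" "f ` {..<\<theta>} \<subseteq> u" using ex_cofinal_map_into[OF u(2) lim] u(1) by blast
    have "G \<delta> (f ` {..<\<theta>})"
      unfolding G_def using cofinal_map_image[OF f(1)] cofinal_map_has_order_type[OF f(1)] covered_mono[OF u(3) f(2)] by blast
    then have "G \<delta> (v \<delta>)" by (rule vG)
    moreover have "v \<delta> \<in> P \<delta>" by (simp add: P_def)
    ultimately show "\<delta> \<in> good'' \<theta> P"
      using u(1) restr[of "v \<delta>"] unfolding good''_def G_def by blast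
  qed
  ultimately show ?thesis using club_in_self[of UNIV] unfolding I_check_def by blast
qed

subsection \<open>The dichotomy\<close>

text \<open>A set stationary in \<open>\<delta>\<close> meets every tail of \<open>\<delta>\<close>,
  so \<open>\<delta>\<close> is a limit of \<open>E\<close>.\<close>

lemma reflects_in_club:
  fixes E :: "'a::wellorder set"
  assumes E: "club_in E UNIV" and S: "S \<subseteq> E" "reflects_in S \<delta>"
  shows "\<delta> \<in> E"
proof (rule club_in_closed[OF E])
  show "limit_ord \<delta>" using S(2) limit_ord_of_uncountable_cf unfolding reflects_in_def by blast
  fix \<beta> assume "\<beta> < \<delta>"
  have "club_in ({..<\<delta>} \<inter> {\<beta>..}) {..<\<delta>}"
  proof (rule club_inI)
    fix z assume "z \<in> {..<\<delta>}"
    then show "\<exists>\<gamma>\<in>{..<\<delta>} \<inter> {\<beta>..}. z \<le> \<gamma>" using \<open>\<beta> < \<delta>\<close> by (intro bexI[of _ "max z \<beta>"]) auto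
  next
    fix z assume z: "z \<in> {..<\<delta>}" "limit_ord z" "\<And>y. y < z \<Longrightarrow> \<exists>x\<in>{..<\<delta>} \<inter> {\<beta>..}. y \<le> x \<and> x < z"
    obtain y where "y < z" using z(2) by (auto simp: limit_ord_def)
    then obtain x where "\<beta> \<le> x" "x < z" using z(3) by blast
    then show "z \<in> {..<\<delta>} \<inter> {\<beta>..}" using z(1) by auto
  qed auto
  moreover have "stationary_in (S \<inter> {..<\<delta>}) {..<\<delta>}" using S(2) by (simp add: reflects_in_def)
  ultimately obtain x where "x \<in> S \<inter> {..<\<delta>}" "x \<in> {..<\<delta>} \<inter> {\<beta>..}" using stationary_inD by blast
  then show "\<exists>z\<in>E. \<beta> \<le> z \<and> z < \<delta>" using S(1) by auto
qed simp

section \<open>The cardinals \<open>\<theta>\<^sup>+\<^sup>n\<close> below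
  \<open>\<lambda>\<close>\<close>

context
  fixes \<theta> :: "'a::wellorder"
  assumes reg: "regular_uncountable (UNIV :: 'a set)"
    and reg_\<theta>: "regular_uncountable {..<\<theta>}"
    and below: "plus_omega_below \<theta>"
    and pow: "\<forall>n. ctwo ^c |{..<card_plus \<theta> n}| <o |UNIV :: 'a set|"
begin

private abbreviation (input) K where "K \<equiv> card_plus \<theta>"

lemma card_plus_infinite: "infinite {..<K n}"
  and card_plus_less: "|{..<K n}| <o |{..<K (Suc n)}|"
  and card_plus_small: "\<alpha> < K (Suc n) \<Longrightarrow> |{..<\<alpha>}| \<le>o |{..<K n}|"
  and cf_card_plus_Suc: "cf (K (Suc n)) = K (Suc n)"
proof -
  have bel: "\<exists>\<nu>::'a. |{..<K m}| <o |{..<\<nu>}|" for m using below unfolding plus_omega_below_def by blast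
  have Suc: "K (Suc m) = card_succ (K m)" for m by (simp add: card_plus_def)
  show inf: "infinite {..<K n}" for n
  proof (induction n)
    case 0
    then show ?case using reg_\<theta> by (auto simp: card_plus_def regular_uncountable_def dest: countable_finite)
  next
    case (Suc n)
    obtain \<nu> :: 'a where "|{..<K n}| <o |{..<\<nu>}|" using bel by blast
    from card_succ_properties(1)[OF Suc.IH this] show ?case
      using Suc.IH card_of_ordLeq_infinite[OF ordLess_imp_ordLeq] by (simp add: card_plus_def)
  qed
  obtain \<nu> :: 'a where \<nu>: "|{..<K n}| <o |{..<\<nu>}|" using bel by blast
  show "|{..<K n}| <o |{..<K (Suc n)}|" "cf (K (Suc n)) = K (Suc n)"
    "\<alpha> < K (Suc n) \<Longrightarrow> |{..<\<alpha>}| \<le>o |{..<K n}|"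
    using card_succ_properties[OF inf \<nu>] unfolding Suc by blast+
qed

lemma cf_card_plus: "cf (K n) = K n"
  using cf_regular_uncountable[OF reg_\<theta>] cf_card_plus_Suc by (cases n) (simp_all add: card_plus_def)

lemma less_of_card_less: "|{..<\<alpha>}| <o |{..<\<beta>::'a}| \<Longrightarrow> \<alpha> < \<beta>"
  using card_of_mono1[of "{..<\<beta>}" "{..<\<alpha>}"] not_ordLess_ordLeq
  by (metis lessThan_subset_iff not_less)

lemma card_plus_mono: "m \<le> n \<Longrightarrow> K m \<le> K n"
  by (rule lift_Suc_mono_le[of K]) (use less_of_card_less[OF card_plus_less] less_imp_le in blast)

lemma card_plus_strict_mono: "m < n \<Longrightarrow> K m < K n"
  by (rule lift_Suc_mono_less[of K]) (use less_of_card_less[OF card_plus_less] in blast)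

lemma uncountable_card_plus: "uncountable {..<K n}"
proof -
  have "{..<\<theta>} \<subseteq> {..<K n}" using card_plus_mono[of 0 n] by (auto simp: card_plus_def)
  moreover have "uncountable {..<\<theta>}" using reg_\<theta> by (simp add: regular_uncountable_def)
  ultimately show ?thesis using countable_subset by blast
qed

lemma limit_of_cf_card_plus: "cf \<delta> = K n \<Longrightarrow> limit_ord \<delta>"
  by (rule limit_ord_of_uncountable_cf) (simp add: uncountable_card_plus)

text \<open>A cofinality above every \<open>K m\<close> would reach
  \<open>card_plus_omega \<theta>\<close>. Being a cardinal, it cannot lie strictly between some
  \<open>K m'\<close> and its successor.\<close>

lemma cf_eq_card_plus:
  assumes "K k \<le> cf \<delta>" "cf \<delta> < card_plus_omega \<theta>"
  shows "\<exists>m\<ge>k. cf \<delta> = K m"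
proof -
  have "\<exists>m. cf \<delta> \<le> K m"
  proof (rule ccontr)
    assume "\<not> ?thesis"
    then have "\<forall>m. |{..<K m}| <o |{..<cf \<delta>}|" by (auto intro!: less_cf_card simp: not_le)
    then have "card_plus_omega \<theta> \<le> cf \<delta>" unfolding card_plus_omega_def by (rule Least_le)
    with assms(2) show False by simp
  qed
  then obtain m0 where "cf \<delta> \<le> K m0" ..
  define m where "m = (LEAST m. cf \<delta> \<le> K m \<and> k \<le> m)"
  have "cf \<delta> \<le> K (max m0 k)"
    using \<open>cf \<delta> \<le> K m0\<close> card_plus_mono[OF max.cobounded1] by (rule order.trans)
  then have "cf \<delta> \<le> K (max m0 k) \<and> k \<le> max m0 k" by simp
  then have m: "cf \<delta> \<le> K m \<and> k \<le> m" unfolding m_def by (rule LeastI)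
  have "K m \<le> cf \<delta>"
  proof (cases "m = k")
    case False
    then obtain m' where m': "m = Suc m'" "k \<le> m'" using m by (cases m) auto
    then have "\<not> (cf \<delta> \<le> K m' \<and> k \<le> m')"
      using not_less_Least[of m' "\<lambda>m. cf \<delta> \<le> K m \<and> k \<le> m"] unfolding m_def by simp
    then have "|{..<K m'}| <o |{..<cf \<delta>}|" using m'(2) by (intro less_cf_card) simp
    then have "card_succ (K m') \<le> cf \<delta>" unfolding card_succ_def by (rule Least_le)
    then show ?thesis using m'(1) by (simp add: card_plus_def)
  qed (use assms(1) in simp)
  with m show ?thesis by (intro exI[of _ m]) auto
qed

lemma card_plus_less_UNIV: "|Pow {..<K n}| <o |UNIV :: 'a set|"
proof -
  have "|Pow {..<K n}| =o ctwo ^c |{..<K n}|"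
    unfolding ctwo_def cexp_def Field_card_of by (rule card_of_Pow_Func)
  with pow show ?thesis using ordIso_ordLess_trans by blast
qed

text \<open>Turns the hypothesis on powers into completeness of the club filter: as many clubs as
  \<open>K n\<close> has subsets may be intersected.\<close>

lemma wide_Pow_card_plus: "wide (Pow {..<K n}) (UNIV :: 'a set)"
  by (rule wide_UNIV[OF reg _ card_plus_less_UNIV]) (simp add: card_plus_infinite)

lemma card_plus_Suc_le_cf:
  assumes "K n < cf \<delta>" shows "K (Suc n) \<le> cf \<delta>"
proof -
  have "|{..<K n}| <o |{..<cf \<delta>}|" using assms by (rule less_cf_card)
  then have "card_succ (K n) \<le> cf \<delta>" unfolding card_succ_def by (rule Least_le)
  then show ?thesis by (simp add: card_plus_def)
qed

text \<open>Below \<open>card_plus_omega \<theta>\<close>, reflection points of \<open>A\<close>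
  have cofinality exactly \<open>K (n + 1)\<close>. If they form a stationary set, it cannot
  reflect, as \<open>A\<close> would then reflect higher up; otherwise a club \<open>E\<close>
  removes them, since reflection points of \<open>A \<inter> E\<close> lie in
  \<open>E\<close>.\<close>

lemma stationary_nonreflecting_subset:
  assumes A: "A \<subseteq> S_cof (K n)" "stationary_in A UNIV"
    and nr: "\<And>\<delta>. cf \<delta> \<in> {K (n + 2)..<card_plus_omega \<theta>} \<Longrightarrow> \<not> reflects_in A \<delta>"
  shows "\<exists>S\<^sub>2 \<subseteq> A. stationary_in S\<^sub>2 UNIV \<and>
    ((\<forall>\<delta>. cf \<delta> < card_plus_omega \<theta> \<longrightarrow> \<not> reflects_in S\<^sub>2 \<delta>) \<or>
     (let S\<^sub>3 = {\<delta> \<in> S_cof (K (n + 1)). stationary_in (S\<^sub>2 \<inter> {..<\<delta>}) {..<\<delta>}}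
      in stationary_in S\<^sub>3 UNIV \<and> (\<forall>\<delta>. cf \<delta> < card_plus_omega \<theta> \<longrightarrow> \<not> reflects_in S\<^sub>3 \<delta>)))"
proof -
  define S\<^sub>3 where "S\<^sub>3 = {\<delta> \<in> S_cof (K (n + 1)). stationary_in (A \<inter> {..<\<delta>}) {..<\<delta>}}"
  show ?thesis
  proof (cases "stationary_in S\<^sub>3 UNIV")
    case True
    have "\<not> reflects_in S\<^sub>3 \<delta>" if \<delta>: "cf \<delta> < card_plus_omega \<theta>" for \<delta>
    proof
      assume r: "reflects_in S\<^sub>3 \<delta>"
      have "K (n + 1) < cf \<delta>" by (rule cf_less_of_reflects_in[OF _ r]) (auto simp: S\<^sub>3_def)
      then have "K (n + 2) \<le> cf \<delta>" using card_plus_Suc_le_cf[of "n + 1" \<delta>] by simp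
      moreover have "reflects_in A \<delta>"
        using r stationary_trace[of \<delta> S\<^sub>3 A] unfolding reflects_in_def S\<^sub>3_def by blast
      ultimately show False using nr[of \<delta>] \<delta> by simp
    qed
    then show ?thesis using True A(2) unfolding S\<^sub>3_def by (intro exI[of _ A]) (simp add: Let_def)
  next
    case False
    then obtain E where E: "club_in E UNIV" "S\<^sub>3 \<inter> E = {}" by (auto simp: stationary_in_def)
    have st: "stationary_in (A \<inter> E) UNIV" by (rule stationary_in_Int_club[OF wide_Pow_card_plus A(2) E(1)])
    have "\<not> reflects_in (A \<inter> E) \<delta>" if \<delta>: "cf \<delta> < card_plus_omega \<theta>" for \<delta>
    proof
      assume r: "reflects_in (A \<inter> E) \<delta>"
      have rA: "reflects_in A \<delta>" using r stationary_in_mono[of "A \<inter> E \<inter> {..<\<delta>}" "{..<\<delta>}" "A \<inter> {..<\<delta>}"]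
        by (auto simp: reflects_in_def)
      have "\<delta> \<in> E" by (rule reflects_in_club[OF E(1) _ r]) blast
      have "K n < cf \<delta>" by (rule cf_less_of_reflects_in[OF A(1) rA])
      then have ge: "K (n + 1) \<le> cf \<delta>" using card_plus_Suc_le_cf[of n \<delta>] by simp
      have "\<not> K (n + 1) < cf \<delta>"
        using card_plus_Suc_le_cf[of "n + 1" \<delta>] nr[of \<delta>] rA \<delta> by auto
      with ge have "cf \<delta> = K (n + 1)" by simp
      then have "\<delta> \<in> S\<^sub>3" using rA by (simp add: S\<^sub>3_def S_cof_def reflects_in_def)
      with \<open>\<delta> \<in> E\<close> E(2) show False by blast
    qed
    then show ?thesis using st by (intro exI[of _ "A \<inter> E"]) auto
  qed
qed

lemma second_possibility_subset:
  assumes "second_possibility \<theta> S n"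
  shows "\<exists>S\<^sub>2 \<subseteq> S_one \<theta> S n. stationary_in S\<^sub>2 UNIV \<and>
    ((\<forall>\<delta>. cf \<delta> < card_plus_omega \<theta> \<longrightarrow> \<not> reflects_in S\<^sub>2 \<delta>) \<or>
     (let S\<^sub>3 = {\<delta> \<in> S_cof (K (n + 1)). stationary_in (S\<^sub>2 \<inter> {..<\<delta>}) {..<\<delta>}}
      in stationary_in S\<^sub>3 UNIV \<and> (\<forall>\<delta>. cf \<delta> < card_plus_omega \<theta> \<longrightarrow> \<not> reflects_in S\<^sub>3 \<delta>)))"
proof -
  obtain F where st: "stationary_in (S_one \<theta> S n) UNIV" and F: "|F| \<le>o ctwo ^c |{..<K n}|" "S_one \<theta> S n = \<Union>F"
    "\<forall>A\<in>F. \<forall>\<delta>. cf \<delta> \<in> {K (n + 2)..<card_plus_omega \<theta>} \<longrightarrow> \<not> reflects_in A \<delta>"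
    using assms unfolding second_possibility_def by blast
  have "ctwo ^c |{..<K n}| =o |Pow {..<K n}|"
    unfolding ctwo_def cexp_def Field_card_of by (rule ordIso_symmetric[OF card_of_Pow_Func])
  then have "|F| \<le>o |Pow {..<K n}|" using F(1) ordLeq_ordIso_trans by blast
  then obtain A where A: "A \<in> F" "stationary_in A UNIV"
    using stationary_in_Union[OF wide_Pow_card_plus] st F(2) by metis
  have sub: "A \<subseteq> S_one \<theta> S n" using A(1) F(2) by blast
  then have "A \<subseteq> S_cof (K n)" by (auto simp: S_one_def)
  from stationary_nonreflecting_subset[OF this A(2)] F(3) A(1)
  obtain S\<^sub>2 where "S\<^sub>2 \<subseteq> A" "stationary_in S\<^sub>2 UNIV"
    "(\<forall>\<delta>. cf \<delta> < card_plus_omega \<theta> \<longrightarrow> \<not> reflects_in S\<^sub>2 \<delta>) \<or>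
     (let S\<^sub>3 = {\<delta> \<in> S_cof (K (n + 1)). stationary_in (S\<^sub>2 \<inter> {..<\<delta>}) {..<\<delta>}}
      in stationary_in S\<^sub>3 UNIV \<and> (\<forall>\<delta>. cf \<delta> < card_plus_omega \<theta> \<longrightarrow> \<not> reflects_in S\<^sub>3 \<delta>))"
    by blast
  then show ?thesis using sub by (intro exI[of _ S\<^sub>2]) auto
qed

text \<open>Adding all ordinals of other cofinality keeps \<open>S\<close> in the ideal, which looks
  only at \<open>S_cof \<theta>\<close>, and leaves a complement inside
  \<open>S_cof \<theta>\<close>. The indices extracted from it then have cofinality
  \<open>\<theta>\<close>, as club guessing requires.\<close>

lemma ex_dichotomy_set:
  "\<exists>S \<subseteq> S_cof \<theta>. S \<in> I_check \<theta> \<and> dichotomy_set \<theta> (S \<union> - S_cof \<theta>)"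
proof -
  \<comment> \<open>All exponents are treated together, so that a single \<open>e\<close>, and hence
    a single \<open>S\<close>, works for every \<open>n\<close>.\<close>
  define R where "R = {\<gamma>. \<exists>n. cf \<gamma> = K n}"
  have "\<forall>\<gamma>. \<exists>h. \<gamma> \<in> R \<longrightarrow> normal_map h (cf \<gamma>) \<gamma>"
    using ex_normal_map limit_of_cf_card_plus unfolding R_def by blast
  then obtain h where h: "\<And>\<gamma>. \<gamma> \<in> R \<Longrightarrow> normal_map (h \<gamma>) (cf \<gamma>) \<gamma>" by metis
  define e where "e \<gamma> = (if \<gamma> \<in> R then h \<gamma> ` {..<cf \<gamma>} else {})" for \<gamma>
  have "\<exists>n. |Pow (e \<gamma>)| \<le>o |Pow {..<K n}|" for \<gamma>
  proof (cases "\<gamma> \<in> R")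
    case True
    then obtain n where "cf \<gamma> = K n" by (auto simp: R_def)
    then have "Pow (e \<gamma>) = image (h \<gamma>) ` Pow {..<K n}"
      using True by (simp add: e_def image_Pow_surj)
    then show ?thesis using card_of_image by metis
  next
    case False
    have "|{{} :: 'a set}| \<le>o |Pow {..<K 0}|" by (rule card_of_mono1) auto
    then show ?thesis using False by (auto simp: e_def)
  qed
  then have Pow_e: "|Pow (e \<gamma>)| <o |UNIV :: 'a set|" for \<gamma>
    using card_plus_less_UNIV ordLeq_ordLess_trans by metis
  define S where "S = {\<delta> \<in> S_cof \<theta>. \<exists>u. unbounded_in u {..<\<delta>} \<and> covered e u}"
  have S: "S \<in> I_check \<theta>"
    unfolding S_def using reg_\<theta> unfolding regular_uncountable_def
    by (intro covered_in_I_check[OF reg _ Pow_e]) blast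
  let ?S = "S \<union> - S_cof \<theta>"
  define bad where "bad = UNIV - ?S"
  have bad: "bad \<subseteq> S_cof \<theta>" "\<And>\<delta> u. \<delta> \<in> bad \<Longrightarrow> unbounded_in u {..<\<delta>} \<Longrightarrow> \<not> covered e u"
    unfolding bad_def S_def by blast+
  have "second_possibility \<theta> ?S n" if n: "n \<ge> 2" and st: "stationary_in (S_one \<theta> ?S n) UNIV" for n
  proof -
    \<comment> \<open>Only limit indices count, since there \<open>h \<delta>\<close> preserves
      cofinality. Colours are subsets of \<open>K n\<close>, which bounds the number of
      pieces.\<close>
    define col where "col \<delta> = {\<epsilon>. \<epsilon> < K n \<and> limit_ord \<epsilon> \<and> h \<delta> \<epsilon> \<in> bad}" for \<delta>
    define piece where "piece X = {\<delta> \<in> S_one \<theta> ?S n. col \<delta> = X}" for X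
    define F where "F = piece ` Pow {..<K n}"
    have S1: "cf \<delta> = K n" "\<delta> \<in> R" "normal_map (h \<delta>) (K n) \<delta>" "stationary_in (bad \<inter> {..<\<delta>}) {..<\<delta>}"
      if "\<delta> \<in> S_one \<theta> ?S n" for \<delta>
      using that h[of \<delta>] unfolding S_one_def S_cof_def R_def refl_set_def reflects_in_def bad_def by auto
    have w: "wide (UNIV :: nat set) {..<K n}" using wide_nat[of "K n"] uncountable_card_plus cf_card_plus by simp
    have "\<not> reflects_in (piece X) \<delta>" if \<delta>: "cf \<delta> \<in> {K (n + 2)..<card_plus_omega \<theta>}" for X \<delta>
    proof
      assume "reflects_in (piece X) \<delta>"
      then have stp: "stationary_in (piece X \<inter> {..<\<delta>}) {..<\<delta>}" by (simp add: reflects_in_def)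
      obtain \<gamma>0 where "\<gamma>0 \<in> piece X" using stationary_inD[OF stp club_in_self] by blast
      then have \<gamma>0: "\<gamma>0 \<in> S_one \<theta> ?S n" "col \<gamma>0 = X" by (auto simp: piece_def)
      obtain m where "n + 2 \<le> m" "cf \<delta> = K m" using cf_eq_card_plus \<delta> by auto
      then have "n < m - 1" "cf \<delta> = K (Suc (m - 1))" by simp_all
      \<comment> \<open>Starting at \<open>n + 2\<close> leaves room for a regular
        \<open>K m'\<close> above \<open>K n\<close> whose successor is
        \<open>cf \<delta>\<close>.\<close>
      then obtain m' where m': "n < m'" "cf \<delta> = K (Suc m')" by blast
      have "stationary_in ({x \<in> {..<K n}. h \<gamma>0 x \<in> bad \<inter> {..<\<gamma>0}} \<inter>
          {\<gamma> \<in> {..<K n}. limit_ord \<gamma> \<and> (\<forall>\<beta><\<gamma>. \<exists>z\<in>{..<K n}. \<beta> < z \<and> z < \<gamma>)}) {..<K n}"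
        by (rule stationary_in_Int_club[OF w normal_map_preimage_stationary[OF S1(3,4)]
              club_in_limit_points[OF w club_in_self]]) (rule \<gamma>0)+
      then have stX: "stationary_in X {..<K n}"
        by (rule stationary_in_mono) (use \<gamma>0(2) in \<open>auto simp: col_def\<close>)
      \<comment> \<open>Points of \<open>X\<close> have cofinality \<open>\<theta>\<close>, so
        \<open>K 1\<close> stages suffice for club guessing; \<open>n \<ge> 2\<close> puts
        \<open>K 1\<close> below \<open>K n\<close>.\<close>
      have cfX: "|{..<cf j}| <o |{..<K 1}|" if "j \<in> X" for j
      proof -
        have j: "j < K n" "limit_ord j" "h \<gamma>0 j \<in> bad" using that \<gamma>0(2) by (auto simp: col_def)
        then have "cf j = \<theta>" using cf_normal_map(1)[OF S1(3)[OF \<gamma>0(1)] j(1,2)] bad(1) by (auto simp: S_cof_def)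
        then show ?thesis using card_plus_less[of 0] by (simp add: card_plus_def)
      qed
      have "\<not> stationary_in (piece X \<inter> {..<\<delta>}) {..<\<delta>}"
      proof (rule nonstationary_of_uncovered[OF cf_card_plus card_plus_infinite[of 1] _ cf_card_plus _ m'(2)
            card_plus_less card_plus_small stX cfX])
        show "|{..<K 1}| <o |{..<K n}|"
          using less_cf_card[of "K 1" "K n"] card_plus_strict_mono[of 1 n] n cf_card_plus by simp
        show "K n < K m'" by (rule card_plus_strict_mono[OF m'(1)])
        fix \<gamma> assume "\<gamma> \<in> piece X"
        then have \<gamma>: "\<gamma> \<in> S_one \<theta> ?S n" "col \<gamma> = X" by (auto simp: piece_def)
        show "cf \<gamma> = K n" "normal_map (h \<gamma>) (K n) \<gamma>" using S1 \<gamma> by auto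
        show "h \<gamma> ` {..<K n} \<subseteq> e \<gamma>" using S1[OF \<gamma>(1)] by (simp add: e_def)
        fix \<epsilon> u assume "\<epsilon> \<in> X" "unbounded_in u {..<h \<gamma> \<epsilon>}"
        then show "\<not> covered e u" using \<gamma>(2) bad(2)[of "h \<gamma> \<epsilon>" u] by (auto simp: col_def)
      qed
      with stp show False by blast
    qed
    moreover have "|F| \<le>o ctwo ^c |{..<K n}|"
    proof -
      have "|Pow {..<K n}| =o ctwo ^c |{..<K n}|"
        unfolding ctwo_def cexp_def Field_card_of by (rule card_of_Pow_Func)
      then show ?thesis unfolding F_def by (rule ordLeq_ordIso_trans[OF card_of_image])
    qed
    moreover have "S_one \<theta> ?S n = \<Union>F"
    proof
      have "col \<delta> \<in> Pow {..<K n}" for \<delta> by (auto simp: col_def)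
      then show "S_one \<theta> ?S n \<subseteq> \<Union>F" unfolding F_def piece_def by blast
    qed (auto simp: F_def piece_def)
    ultimately show ?thesis using st unfolding second_possibility_def F_def by blast
  qed
  moreover have "?S \<inter> S_cof \<theta> = S" unfolding S_def by blast
  ultimately have "dichotomy_set \<theta> ?S" using S unfolding dichotomy_set_def in_I_check_def by auto
  then show ?thesis using S by (intro exI[of _ S]) (auto simp: S_def)
qed

text \<open>The sets that are nonstationary outside \<open>S'\<close> form an ideal containing the
  generators, so the generated ideal consists of such sets.\<close>

lemma nonstationary_Diff_S_bd:
  assumes B: "is_S_bd \<theta> B" and S: "S \<in> I_check \<theta>"
  shows "\<not> stationary_in (S \<inter> B) UNIV"
proof -
  obtain S' where S': "S' \<subseteq> S_cof \<theta>" "B = S_cof \<theta> - S'"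
    "I_check \<theta> = generated_ideal (S_cof \<theta>) ({A. A \<subseteq> S_cof \<theta> \<and> \<not> stationary_in A UNIV} \<union> {S'})"
    using B unfolding is_S_bd_def by blast
  let ?J = "{A. A \<subseteq> S_cof \<theta> \<and> \<not> stationary_in (A - S') UNIV}"
  have ns_mono: "\<not> stationary_in A' (UNIV :: 'a set)" if "\<not> stationary_in A UNIV" "A' \<subseteq> A" for A A' :: "'a set"
    using that stationary_in_mono[of A' UNIV A] by blast
  have ns_empty: "\<not> stationary_in {} (UNIV :: 'a set)" using club_in_self by (auto simp: stationary_in_def)
  have ns_Un: "\<not> stationary_in (A \<union> A') (UNIV :: 'a set)"
    if A: "\<not> stationary_in A UNIV" "\<not> stationary_in A' UNIV" for A A' :: "'a set"
  proof
    assume "stationary_in (A \<union> A') (UNIV :: 'a set)"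
    then have "stationary_in (\<Union>{A, A'}) (UNIV :: 'a set)" by simp
    moreover have "|{A, A'}| \<le>o |Pow {..<K 0}|"
      using card_plus_infinite[of 0] by (intro ordLess_imp_ordLeq card_finite_less_infinite) auto
    ultimately show False using stationary_in_Union[OF wide_Pow_card_plus[of 0]] A by blast
  qed
  have "set_ideal_on (S_cof \<theta>) ?J"
    unfolding set_ideal_on_def
  proof (intro conjI ballI allI impI)
    fix A C assume "A \<in> ?J" "C \<subseteq> A"
    then show "C \<in> ?J" using ns_mono[of "A - S'" "C - S'"] by auto
  next
    fix A C assume "A \<in> ?J" "C \<in> ?J"
    then show "A \<union> C \<in> ?J" using ns_Un[of "A - S'" "C - S'"] by (auto simp: Un_Diff)
  qed (use ns_empty in auto)
  moreover have "{A. A \<subseteq> S_cof \<theta> \<and> \<not> stationary_in A UNIV} \<union> {S'} \<subseteq> ?J"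
    using ns_mono[OF _ Diff_subset] ns_empty S'(1) by auto
  ultimately have "I_check \<theta> \<subseteq> ?J" unfolding S'(3) generated_ideal_def by blast
  then have "\<not> stationary_in (S - S') UNIV" using S by blast
  then show ?thesis by (rule ns_mono) (use S'(2) in auto)
qed

text \<open>If the second possibility holds for some \<open>n \<ge> 2\<close>, its outcome is as
  required. Otherwise clubs avoid every \<open>S_one\<close> from exponent 2 on; \<open>B\<close>
  cut down by them reflects at no \<open>K m\<close> with \<open>m \<ge> 2\<close>, and the argument
  for (3) applies to it at exponent 0.\<close>

lemma ex_nonreflecting_of_S_bd:
  assumes B: "is_S_bd \<theta> B" "stationary_in B UNIV"
  shows "\<exists>n S. S \<subseteq> S_cof (K n) \<and> stationary_in S UNIV \<and>
    (\<forall>\<delta>. cf \<delta> \<in> {\<theta>..<card_plus_omega \<theta>} \<longrightarrow> \<not> reflects_in S \<delta>)"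
proof -
  have fin: "\<exists>n S. S \<subseteq> S_cof (K n) \<and> stationary_in S UNIV \<and>
      (\<forall>\<delta>. cf \<delta> \<in> {\<theta>..<card_plus_omega \<theta>} \<longrightarrow> \<not> reflects_in S \<delta>)"
    if A: "\<exists>S\<^sub>2 \<subseteq> A. stationary_in S\<^sub>2 UNIV \<and>
      ((\<forall>\<delta>. cf \<delta> < card_plus_omega \<theta> \<longrightarrow> \<not> reflects_in S\<^sub>2 \<delta>) \<or>
       (let S\<^sub>3 = {\<delta> \<in> S_cof (K (n + 1)). stationary_in (S\<^sub>2 \<inter> {..<\<delta>}) {..<\<delta>}}
        in stationary_in S\<^sub>3 UNIV \<and> (\<forall>\<delta>. cf \<delta> < card_plus_omega \<theta> \<longrightarrow> \<not> reflects_in S\<^sub>3 \<delta>)))"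
      "A \<subseteq> S_cof (K n)" for A n
  proof -
    obtain S\<^sub>2 where S2: "S\<^sub>2 \<subseteq> S_cof (K n)" "stationary_in S\<^sub>2 UNIV"
      "(\<forall>\<delta>. cf \<delta> < card_plus_omega \<theta> \<longrightarrow> \<not> reflects_in S\<^sub>2 \<delta>) \<or>
       (let S\<^sub>3 = {\<delta> \<in> S_cof (K (n + 1)). stationary_in (S\<^sub>2 \<inter> {..<\<delta>}) {..<\<delta>}}
        in stationary_in S\<^sub>3 UNIV \<and> (\<forall>\<delta>. cf \<delta> < card_plus_omega \<theta> \<longrightarrow> \<not> reflects_in S\<^sub>3 \<delta>))"
      using A by (meson order.trans)
    from S2(3) show ?thesis
    proof
      assume "\<forall>\<delta>. cf \<delta> < card_plus_omega \<theta> \<longrightarrow> \<not> reflects_in S\<^sub>2 \<delta>"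
      then show ?thesis using S2 by (intro exI[of _ n] exI[of _ S\<^sub>2]) simp
    next
      let ?S3 = "{\<delta> \<in> S_cof (K (n + 1)). stationary_in (S\<^sub>2 \<inter> {..<\<delta>}) {..<\<delta>}}"
      assume "let S\<^sub>3 = ?S3 in stationary_in S\<^sub>3 UNIV \<and>
        (\<forall>\<delta>. cf \<delta> < card_plus_omega \<theta> \<longrightarrow> \<not> reflects_in S\<^sub>3 \<delta>)"
      then show ?thesis by (intro exI[of _ "n + 1"] exI[of _ ?S3]) (simp add: Let_def)
    qed
  qed
  obtain S where S: "S \<subseteq> S_cof \<theta>" "S \<in> I_check \<theta>" "dichotomy_set \<theta> (S \<union> - S_cof \<theta>)"
    using ex_dichotomy_set by blast
  let ?S = "S \<union> - S_cof \<theta>"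
  show ?thesis
  proof (cases "\<exists>n\<ge>2. second_possibility \<theta> ?S n")
    case True
    then obtain n where "second_possibility \<theta> ?S n" by blast
    from fin[OF second_possibility_subset[OF this]] show ?thesis by (auto simp: S_one_def)
  next
    case False
    then have "\<forall>n\<ge>2. \<not> stationary_in (S_one \<theta> ?S n) UNIV" using S(3) by (auto simp: dichotomy_set_def)
    then have "\<forall>n. \<exists>E. club_in E UNIV \<and> (n \<ge> 2 \<longrightarrow> S_one \<theta> ?S n \<inter> E = {})"
      using club_in_self unfolding stationary_in_def by (metis subset_UNIV)
    then obtain E where E: "\<And>n. club_in (E n) UNIV" "\<And>n. n \<ge> 2 \<Longrightarrow> S_one \<theta> ?S n \<inter> E n = {}" by metis
    \<comment> \<open>Up to a club \<open>B\<close> is disjoint from \<open>S\<close>, so it lies in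
      the complement whose reflection points make up \<open>S_one\<close>.\<close>
    obtain E0 where E0: "club_in E0 UNIV" "S \<inter> B \<inter> E0 = {}"
      using nonstationary_Diff_S_bd[OF B(1) S(2)] by (auto simp: stationary_in_def)
    have w: "wide (Pow {..<K 0}) (UNIV :: 'a set)" by (rule wide_Pow_card_plus)
    have "|UNIV :: nat set| \<le>o |Pow {..<K 0}|"
      using card_plus_infinite[of 0] infinite_iff_card_of_nat[of "Pow {..<K 0}"] by simp
    from club_in_INT[OF w this E(1)] have CE: "club_in (UNIV \<inter> (\<Inter>n. E n)) UNIV" .
    define E1 where "E1 = (\<Inter>n. E n) \<inter> E0"
    have E1: "club_in E1 UNIV" unfolding E1_def using club_in_Int[OF w CE E0(1)] by simp
    define A where "A = B \<inter> E1"
    have stA: "stationary_in A UNIV" unfolding A_def by (rule stationary_in_Int_club[OF w B(2) E1])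
    have "B \<subseteq> S_cof \<theta>" using B(1) unfolding is_S_bd_def by blast
    then have Ab: "A \<subseteq> UNIV - ?S" and A0: "A \<subseteq> S_cof (K 0)"
      using E0(2) unfolding A_def E1_def by (auto simp: card_plus_def)
    \<comment> \<open>A reflection point of cofinality \<open>K m\<close> would lie in
      \<open>S_one\<close> and also in the club \<open>E m\<close> chosen to avoid it.\<close>
    have nr: "\<not> reflects_in A \<delta>" if \<delta>: "cf \<delta> \<in> {K (0 + 2)..<card_plus_omega \<theta>}" for \<delta>
    proof
      assume r: "reflects_in A \<delta>"
      have "K 2 \<le> cf \<delta>" "cf \<delta> < card_plus_omega \<theta>" using \<delta> by (simp_all add: numeral_2_eq_2)
      then obtain m where m: "m \<ge> 2" "cf \<delta> = K m" using cf_eq_card_plus by blast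
      have stA\<delta>: "stationary_in (A \<inter> {..<\<delta>}) {..<\<delta>}" using r by (simp add: reflects_in_def)
      have "stationary_in ((UNIV - ?S) \<inter> {..<\<delta>}) {..<\<delta>}"
        by (rule stationary_in_mono[OF stA\<delta>]) (use Ab in auto)
      then have "\<delta> \<in> S_one \<theta> ?S m"
        using r m(2) by (simp add: S_one_def S_cof_def refl_set_def reflects_in_def)
      moreover have "\<delta> \<in> E m" by (rule reflects_in_club[OF E(1) _ r]) (auto simp: A_def E1_def)
      ultimately show False using E(2)[OF m(1)] by blast
    qed
    from fin[OF stationary_nonreflecting_subset[OF A0 stA nr] A0] show ?thesis by simp
  qed
qed

end

theorem theorem0p2:
  fixes \<theta> :: "'a::wellorder"
  assumes "regular_uncountable (UNIV :: 'a set)"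
    and "regular_uncountable {..<\<theta>}"
    and "plus_omega_below \<theta>"
    and "\<forall>n. ctwo ^c |{..<card_plus \<theta> n}| <o |UNIV :: 'a set|"
  shows
    "(\<forall>B. is_S_bd \<theta> B \<and> stationary_in B UNIV \<longrightarrow>
        (\<exists>n S. S \<subseteq> S_cof (card_plus \<theta> n) \<and> stationary_in S UNIV \<and>
           (\<forall>\<delta>. cf \<delta> \<in> {\<theta>..<card_plus_omega \<theta>} \<longrightarrow> \<not> reflects_in S \<delta>)))
     \<and> (\<exists>S. dichotomy_set \<theta> S)
     \<and> (\<forall>S n. dichotomy_set \<theta> S \<and> n \<ge> 2 \<and> second_possibility \<theta> S n \<longrightarrow>
        (\<exists>S\<^sub>2 \<subseteq> S_one \<theta> S n. stationary_in S\<^sub>2 UNIV \<and>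
           ((\<forall>\<delta>. cf \<delta> < card_plus_omega \<theta> \<longrightarrow> \<not> reflects_in S\<^sub>2 \<delta>) \<or>
            (let S\<^sub>3 = {\<delta> \<in> S_cof (card_plus \<theta> (n + 1)). stationary_in (S\<^sub>2 \<inter> {..<\<delta>}) {..<\<delta>}}
             in stationary_in S\<^sub>3 UNIV \<and>
                (\<forall>\<delta>. cf \<delta> < card_plus_omega \<theta> \<longrightarrow> \<not> reflects_in S\<^sub>3 \<delta>)))))"
proof (intro conjI allI impI)
  fix B assume "is_S_bd \<theta> B \<and> stationary_in B UNIV"
  then show "\<exists>n S. S \<subseteq> S_cof (card_plus \<theta> n) \<and> stationary_in S UNIV \<and>
      (\<forall>\<delta>. cf \<delta> \<in> {\<theta>..<card_plus_omega \<theta>} \<longrightarrow> \<not> reflects_in S \<delta>)"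
    using ex_nonreflecting_of_S_bd[OF assms] by blast
next
  show "\<exists>S. dichotomy_set \<theta> S" using ex_dichotomy_set[OF assms] by blast
qed (use second_possibility_subset[OF assms] in blast)

end
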